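(* Let $n\ge1$, let $\mathfrak g$ be a finite-dimensional simple complex Lie algebra with Cartan subalgebra $\mathfrak h$, let $\mathcal L$ be the associated full toroidal Lie algebra, let $\Lambda\in(\mathbb C^* )^n$, $a\in\mathbb C$ and $M_{\mathfrak g}\in\mathcal M(\mathfrak g,\mathfrak h)$. The $\mathcal L$-module $\widehat M_{\mathcal L}(\Lambda,a,M_{\mathfrak g})$ is simple if and only if the $\mathfrak g$-module $M_{\mathfrak g}$ is simple.
   Context: All vector spaces, algebras and tensor products are over $\mathbb C$. $U(\mathfrak a)$ denotes the universal enveloping algebra of a Lie algebra $\mathfrak a$. Category: for a Lie algebra $\mathfrak a$ and a finite-dimensional abelian subalgebra $\mathfrak b\subseteq\mathfrak a$, $\mathcal M(\mathfrak a,\mathfrak b)$ is the full subcategory of $U(\mathfrak a)$-modules whose restriction to $U(\mathfrak b)$ is free of rank $1$. Each object is identified with the vector space $U(\mathfrak b)$ on which $\mathfrak b$ acts by multiplication. Notation for $\mathfrak g$: $\mathfrak g$ is a finite-dimensional simple Lie algebra of rank $l$ with Chevalley generators $x_i,y_i,h_i$ ($1\le i\le l$), and $\{H_1,\dots,H_l\}$ is the basis of $\mathfrak h$ with $[H_i,x_j]=\delta_{ij}x_i$, $[H_i,y_j]=-\delta_{ij}y_j$. $(\cdot,\cdot)$ is the Killing form. Full toroidal Lie algebra: let $A=\mathbb C[t_1^{\pm1},\dots,t_n^{\pm1}]$, $t^m=t_1^{m_1}\cdots t_n^{m_n}$ for $m\in\mathbb Z^n$; $\Omega_A$ is the free $A$-module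 with basis $K_1,\dots,K_n$; $dA\subseteq\Omega_A$ is the span of the elements $\sum_i m_it^mK_i$, $m\in\mathbb Z^n$; $\mathcal K_A=\Omega_A/dA$; $\mathrm{Der}(A)$ is the space of derivations of $A$, with basis $t^rd_i$ ($r\in\mathbb Z^n$, $1\le i\le n$), where $d_i=t_i\,\partial/\partial t_i$. For $u\in\mathbb C^n$ put $D(u,r)=\sum_iu_it^rd_i$, and $(u,v)=\sum_i u_iv_i$. Let $\phi$ be a fixed arbitrary linear combination of the $\mathcal K_A$-valued 2-cocycles $\phi_1(t^rd_i,t^sd_j)=-s_ir_j\sum_pr_pt^{r+s}K_p$ and $\phi_2(t^rd_i,t^sd_j)=r_is_j\sum_pr_pt^{r+s}K_p$ on $\mathrm{Der}(A)$. With $x(r)=x\otimes t^r$, $\mathcal L=(\mathfrak g\otimes A)\oplus\mathcal K_A\oplus\mathrm{Der}(A)$ has brackets $[x(r),y(s)]=[x,y](r+s)+(x,y)\sum_ir_it^{r+s}K_i$; $[\mathfrak g\otimes A,\mathcal K_A]=[\mathcal K_A,\mathcal K_A]=0$; $[t^rd_i,t^sK_j]=s_it^{r+s}K_j+\delta_{ij}\sum_pr_pt^{r+s}K_p$; $[D(u,r),D(v,s)]=D(w,r+s)+\phi(D(u,r),D(v,s))$ with $w=(u,s)v-(v,r)u$; $[D(u,r),x(s)]=(u,s)x(r+s)$. Put $D=\bigoplus_i\mathbb Cd_i$ and $\widetilde{\mathfrak h}_n=\mathfrak h\oplus D\subset\mathcal L$, so $U(\widetilde{\mathfrak h}_n)=\mathbb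 C[H_1,\dots,H_l,d_1,\dots,d_n]$. Automorphisms of $U(\widetilde{\mathfrak h}_n)$: $\sigma_i$ sends $H_i\mapsto H_i-1$ and fixes all other generators; $\tau_j$ sends $d_j\mapsto d_j-1$ and fixes all other generators. For $r\in\mathbb Z^n$, $\tau^r=\tau_1^{r_1}\cdots\tau_n^{r_n}$ and, for $\Lambda=(\lambda_1,\dots,\lambda_n)$, $\Lambda^r=\lambda_1^{r_1}\cdots\lambda_n^{r_n}$. The module $\widehat M_{\mathcal L}(\Lambda,a,M_{\mathfrak g})$: for $M_{\mathfrak g}\in\mathcal M(\mathfrak g,\mathfrak h)$, $\Lambda\in(\mathbb C^* )^n$, $a\in\mathbb C$, it is the space $U(\widetilde{\mathfrak h}_n)$ with, for $g\in U(\widetilde{\mathfrak h}_n)$, $r\in\mathbb Z^n$, $h\in\mathfrak h$: $t^rK_j.g=0$; $h(r).g=\Lambda^rh\,\tau^r(g)$; $x_i(r).g=\Lambda^r\sigma_i\tau^r(g)(x_i.1)$; $y_i(r).g=\Lambda^r\sigma_i^{-1}\tau^r(g)(y_i.1)$; $t^rd_j.g=\Lambda^r\tau^r(g)\,(d_j-r_j(a+1))$, where $x_i.1,y_i.1\in U(\mathfrak h)$ are given by the $\mathfrak g$-module structure of $M_{\mathfrak g}=U(\mathfrak h)$. This defines an $\mathcal L$-module. *)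

theory Defs
  imports "HOL-Analysis.Analysis" "HOL-Library.Poly_Mapping"
begin

section \<open>Lie algebras and their modules\<close>

locale lie_algebra = vector_space scale
  for scale :: "complex \<Rightarrow> 'g::ab_group_add \<Rightarrow> 'g" +
  fixes br :: "'g \<Rightarrow> 'g \<Rightarrow> 'g"
  assumes br_linear_left: "Vector_Spaces.linear scale scale (\<lambda>x. br x y)"
    and br_linear_right: "Vector_Spaces.linear scale scale (br x)"
    and br_self: "br x x = 0"
    and jacobi: "br x (br y z) + br y (br z x) + br z (br x y) = 0"
begin

definition subalgebra :: "'g set \<Rightarrow> bool" where
  "subalgebra S \<longleftrightarrow> subspace S \<and> (\<forall>x\<in>S. \<forall>y\<in>S. br x y \<in> S)"

definition ideal :: "'g set \<Rightarrow> bool" where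
  "ideal I \<longleftrightarrow> subspace I \<and> (\<forall>x. \<forall>y\<in>I. br x y \<in> I)"

fun lower_central :: "'g set \<Rightarrow> nat \<Rightarrow> 'g set" where
  "lower_central S 0 = S"
| "lower_central S (Suc k) = span {br x y |x y. x \<in> S \<and> y \<in> lower_central S k}"

definition nilpotent :: "'g set \<Rightarrow> bool" where
  "nilpotent S \<longleftrightarrow> (\<exists>k. lower_central S k = {0})"

definition normalizer :: "'g set \<Rightarrow> 'g set" where
  "normalizer S = {x. \<forall>y\<in>S. br x y \<in> S}"

definition cartan_subalgebra :: "'g set \<Rightarrow> bool" where
  "cartan_subalgebra S \<longleftrightarrow> subalgebra S \<and> nilpotent S \<and> normalizer S = S"

definition lin_trace :: "('g \<Rightarrow> 'g) \<Rightarrow> complex" where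
  "lin_trace f = (let B = (SOME B. independent B \<and> span B = UNIV)
                  in \<Sum>b\<in>B. representation B (f b) b)"

definition killing :: "'g \<Rightarrow> 'g \<Rightarrow> complex" where
  "killing x y = lin_trace (\<lambda>z. br x (br y z))"

text \<open>Functionals on \<open>S\<close> are functions on the whole of \<open>'g\<close>, of which only the values on \<open>S\<close>
  matter.\<close>

definition weight_space :: "'g set \<Rightarrow> ('g \<Rightarrow> complex) \<Rightarrow> 'g set" where
  "weight_space S \<alpha> = {x. \<forall>h\<in>S. br h x = scale (\<alpha> h) x}"

definition is_root :: "'g set \<Rightarrow> ('g \<Rightarrow> complex) \<Rightarrow> bool" where
  "is_root S \<alpha> \<longleftrightarrow> (\<exists>h\<in>S. \<alpha> h \<noteq> 0) \<and> weight_space S \<alpha> \<noteq> {0}"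

definition root_base :: "'g set \<Rightarrow> ('l::finite \<Rightarrow> 'g \<Rightarrow> complex) \<Rightarrow> bool" where
  "root_base S \<alpha> \<longleftrightarrow>
     (\<forall>i. is_root S (\<alpha> i)) \<and>
     (\<forall>c. (\<forall>h\<in>S. (\<Sum>i\<in>UNIV. c i * \<alpha> i h) = 0) \<longrightarrow> (\<forall>i. c i = 0)) \<and>
     (\<forall>\<beta>. is_root S \<beta> \<longrightarrow>
        (\<exists>k::'l \<Rightarrow> int. ((\<forall>i. 0 \<le> k i) \<or> (\<forall>i. k i \<le> 0)) \<and>
           (\<forall>h\<in>S. \<beta> h = (\<Sum>i\<in>UNIV. of_int (k i) * \<alpha> i h))))"

definition chevalley_generators ::
  "'g set \<Rightarrow> ('l::finite \<Rightarrow> 'g) \<Rightarrow> ('l \<Rightarrow> 'g) \<Rightarrow> ('l \<Rightarrow> 'g) \<Rightarrow> bool" where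
  "chevalley_generators S x y h \<longleftrightarrow>
     (\<exists>\<alpha>. root_base S \<alpha> \<and>
       (\<forall>i. x i \<in> weight_space S (\<alpha> i) \<and> y i \<in> weight_space S (\<lambda>z. - \<alpha> i z) \<and>
            br (x i) (y i) = h i \<and> \<alpha> i (h i) = 2)) \<and>
     (\<forall>T. subalgebra T \<and> range x \<union> range y \<union> range h \<subseteq> T \<longrightarrow> T = UNIV)"

end

locale simple_lie_algebra = lie_algebra +
  assumes finite_dim: "\<exists>B. finite B \<and> span B = UNIV"
    and not_abelian: "\<exists>x y. br x y \<noteq> 0"
    and no_proper_ideal: "ideal I \<Longrightarrow> I = {0} \<or> I = UNIV"

text \<open>The index type \<open>'l\<close> has as many elements as the rank, since \<open>H\<close> enumerates a basis of \<open>\<hh>\<close>.\<close>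

locale chevalley_lie_algebra = simple_lie_algebra scale br
  for scale :: "complex \<Rightarrow> 'g::ab_group_add \<Rightarrow> 'g" and br :: "'g \<Rightarrow> 'g \<Rightarrow> 'g" +
  fixes \<hh> :: "'g set" and x y h H :: "'l::finite \<Rightarrow> 'g"
  assumes cartan: "cartan_subalgebra \<hh>"
    and chevalley: "chevalley_generators \<hh> x y h"
    and H_inj: "inj H"
    and H_independent: "independent (range H)"
    and H_span: "span (range H) = \<hh>"
    and H_x: "br (H i) (x j) = (if i = j then x j else 0)"
    and H_y: "br (H i) (y j) = (if i = j then - y j else 0)"

definition lie_module ::
  "(complex \<Rightarrow> 'g::ab_group_add \<Rightarrow> 'g) \<Rightarrow> ('g \<Rightarrow> 'g \<Rightarrow> 'g) \<Rightarrow> (complex \<Rightarrow> 'v::ab_group_add \<Rightarrow> 'v) \<Rightarrow>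
   ('g \<Rightarrow> 'v \<Rightarrow> 'v) \<Rightarrow> bool" where
  "lie_module scaleG br scaleV act \<longleftrightarrow>
     (\<forall>x. Vector_Spaces.linear scaleV scaleV (act x)) \<and>
     (\<forall>v. Vector_Spaces.linear scaleG scaleV (\<lambda>x. act x v)) \<and>
     (\<forall>x y v. act (br x y) v = act x (act y v) - act y (act x v))"

definition simple_lie_module ::
  "(complex \<Rightarrow> 'g::ab_group_add \<Rightarrow> 'g) \<Rightarrow> ('g \<Rightarrow> 'g \<Rightarrow> 'g) \<Rightarrow> (complex \<Rightarrow> 'v::ab_group_add \<Rightarrow> 'v) \<Rightarrow>
   ('g \<Rightarrow> 'v \<Rightarrow> 'v) \<Rightarrow> bool" where
  "simple_lie_module scaleG br scaleV act \<longleftrightarrow>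
     lie_module scaleG br scaleV act \<and>
     (UNIV :: 'v set) \<noteq> {0} \<and>
     (\<forall>W. module.subspace scaleV W \<and> (\<forall>x. \<forall>w\<in>W. act x w \<in> W) \<longrightarrow> W = {0} \<or> W = UNIV)"

section \<open>Finitely supported functions\<close>

text \<open>For a vector space \<open>V\<close>, the type \<open>(int ^ 'n) \<Rightarrow>\<^sub>0 V\<close> is \<open>V \<otimes> A\<close> with \<open>A\<close> the Laurent
  polynomials in \<open>'n\<close> variables; \<open>single r v\<close> is \<open>v \<otimes> t\<^sup>r\<close>.\<close>

definition pm_scale :: "(complex \<Rightarrow> 'b::zero \<Rightarrow> 'b) \<Rightarrow> complex \<Rightarrow> ('k \<Rightarrow>\<^sub>0 'b) \<Rightarrow> ('k \<Rightarrow>\<^sub>0 'b)" where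
  "pm_scale s c p = Poly_Mapping.map (s c) p"

definition lin_ext :: "('k \<Rightarrow> 'a \<Rightarrow> 'c) \<Rightarrow> ('k \<Rightarrow>\<^sub>0 'a::zero) \<Rightarrow> 'c::comm_monoid_add" where
  "lin_ext b p = (\<Sum>k\<in>Poly_Mapping.keys p. b k (Poly_Mapping.lookup p k))"

lemma lookup_pm_scale:
  assumes "vector_space s"
  shows "Poly_Mapping.lookup (pm_scale s c p) k = s c (Poly_Mapping.lookup p k)"
proof -
  interpret vector_space s by fact
  show ?thesis by (simp add: pm_scale_def Poly_Mapping.map.rep_eq when_def)
qed

lemma vector_space_pm_scale:
  assumes "vector_space s" shows "vector_space (pm_scale s)"
proof -
  interpret vector_space s by fact
  show ?thesis
    by unfold_locales
      (auto intro!: poly_mapping_eqI simp: lookup_pm_scale[OF assms] lookup_add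
        scale_right_distrib scale_left_distrib)
qed

lemma pm_scale_single:
  assumes "vector_space s"
  shows "pm_scale s c (Poly_Mapping.single k v) = Poly_Mapping.single k (s c v)"
proof -
  interpret vector_space s by fact
  show ?thesis
    by (auto intro!: poly_mapping_eqI simp: lookup_pm_scale[OF assms] lookup_single when_def)
qed

lemma vector_space_vec_scale: "vector_space ((*s) :: complex \<Rightarrow> complex ^ 'n \<Rightarrow> complex ^ 'n)"
  by unfold_locales (auto simp: vec_eq_iff algebra_simps)

lemma vector_space_complex: "vector_space ((*) :: complex \<Rightarrow> complex \<Rightarrow> complex)"
  by unfold_locales (auto simp: algebra_simps)

lemma lin_ext_superset:
  assumes "finite S" "Poly_Mapping.keys p \<subseteq> S" "\<And>k. b k 0 = 0"
  shows "lin_ext b p = (\<Sum>k\<in>S. b k (Poly_Mapping.lookup p k))"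
  unfolding lin_ext_def using assms
  by (intro sum.mono_neutral_left) (auto simp: in_keys_iff)

lemma lin_ext_zero [simp]: "lin_ext b 0 = 0"
  by (simp add: lin_ext_def)

lemma lin_ext_single:
  "b k 0 = 0 \<Longrightarrow> lin_ext b (Poly_Mapping.single k v) = b k v"
  by (cases "v = 0") (auto simp: lin_ext_def)

lemma lin_ext_add:
  assumes "\<And>k. b k 0 = 0" "\<And>k u v. b k (u + v) = b k u + b k v"
  shows "lin_ext b (p + q) = lin_ext b p + lin_ext b q"
proof -
  let ?S = "Poly_Mapping.keys p \<union> Poly_Mapping.keys q"
  have *: "finite ?S" by simp
  show ?thesis
    using lin_ext_superset[of ?S p b] lin_ext_superset[of ?S q b]
      lin_ext_superset[of ?S "p + q" b] assms keys_add[of p q]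
    by (simp add: sum.distrib lookup_add)
qed

lemma lin_ext_scale:
  assumes "vector_space s" "\<And>k. b k 0 = 0" "\<And>k u. b k (s c u) = f (b k u)"
    "f 0 = 0" "\<And>u v. f (u + v) = f u + f v"
  shows "lin_ext b (pm_scale s c p) = f (lin_ext b p)"
proof -
  interpret vector_space s by fact
  have "Poly_Mapping.keys (pm_scale s c p) \<subseteq> Poly_Mapping.keys p"
    by (auto simp: in_keys_iff lookup_pm_scale[OF assms(1)])
  then have "lin_ext b (pm_scale s c p) =
      (\<Sum>k\<in>Poly_Mapping.keys p. f (b k (Poly_Mapping.lookup p k)))"
    using lin_ext_superset[of "Poly_Mapping.keys p" "pm_scale s c p" b] assms
    by (simp add: lookup_pm_scale[OF assms(1)])
  also have "\<dots> = f (lin_ext b p)"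
    unfolding lin_ext_def using finite_keys[of p]
    by (induction rule: finite_induct) (auto simp: assms)
  finally show ?thesis .
qed

lemma pm_induct [case_names zero add]:
  assumes "P 0" "\<And>p k v. P p \<Longrightarrow> P (p + Poly_Mapping.single k v)"
  shows "P (p :: 'k \<Rightarrow>\<^sub>0 'a::comm_monoid_add)"
proof -
  have "finite K \<Longrightarrow> P (\<Sum>k\<in>K. Poly_Mapping.single k (Poly_Mapping.lookup p k))" for K
    by (induction rule: finite_induct)
      (simp_all add: assms(1) assms(2)[of "\<Sum>k\<in>F. f k" for F f, unfolded add.commute[of "sum _ _"]])
  moreover have "(\<Sum>k\<in>Poly_Mapping.keys p. Poly_Mapping.single k (Poly_Mapping.lookup p k)) = p"
    by (rule poly_mapping_eqI)
      (auto simp: lookup_sum lookup_single when_def in_keys_iff if_distrib sum.If_cases)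
  ultimately show ?thesis by (metis finite_keys)
qed

lemma additive_pm_eqI:
  fixes f g :: "('k \<Rightarrow>\<^sub>0 'a::comm_monoid_add) \<Rightarrow> 'c::ab_group_add"
  assumes "\<And>p q. f (p + q) = f p + f q" "\<And>p q. g (p + q) = g p + g q"
    "\<And>k v. f (Poly_Mapping.single k v) = g (Poly_Mapping.single k v)"
  shows "f p = g p"
proof (induction p rule: pm_induct)
  case zero
  show ?case using assms(1)[of 0 0] assms(2)[of 0 0] by simp
qed (simp add: assms)

section \<open>The full toroidal Lie algebra\<close>

definition cvec :: "int ^ 'n \<Rightarrow> complex ^ 'n" where
  "cvec r = (\<chi> i. of_int (r $ i))"

definition dotc :: "complex ^ 'n \<Rightarrow> complex ^ 'n \<Rightarrow> complex" where
  "dotc u v = (\<Sum>i\<in>UNIV. u $ i * v $ i)"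

text \<open>\<open>\<Omega>\<^sub>A\<close>, the free \<open>A\<close>-module on \<open>K\<^sub>1, \<dots>, K\<^sub>n\<close>, is \<open>\<complex>\<^sup>n \<otimes> A\<close>: \<open>single r v\<close> is
  \<open>\<Sum>\<^sub>p v\<^sub>p t\<^sup>r K\<^sub>p\<close>.  Likewise \<open>Der(A)\<close> is written in its basis \<open>t\<^sup>r d\<^sub>i\<close>: \<open>single r u\<close> is \<open>D(u,r)\<close>;
  \<open>bij_betw_der_act\<close> identifies these coordinates with the derivations of \<open>A\<close>.\<close>

type_synonym 'n omega = "(int ^ 'n) \<Rightarrow>\<^sub>0 (complex ^ 'n)"
type_synonym 'n der = "(int ^ 'n) \<Rightarrow>\<^sub>0 (complex ^ 'n)"

definition dA :: "('n::finite) omega set" where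
  "dA = module.span (pm_scale (*s)) (range (\<lambda>m. Poly_Mapping.single m (cvec m)))"

interpretation omega: vector_space "pm_scale (*s) :: complex \<Rightarrow> ('n::finite) omega \<Rightarrow> 'n omega"
  by (rule vector_space_pm_scale[OF vector_space_vec_scale])

lemma subspace_dA: "omega.subspace dA"
  unfolding dA_def by (rule omega.subspace_span)

quotient_type (overloaded) 'n KA = "('n::finite) omega" / "\<lambda>x y. x - y \<in> dA"
proof (rule equivpI)
  show "reflp (\<lambda>x y. x - y \<in> (dA :: 'n omega set))"
    by (auto simp: reflp_def omega.subspace_0[OF subspace_dA])
  show "symp (\<lambda>x y. x - y \<in> (dA :: 'n omega set))"
    using omega.subspace_neg[OF subspace_dA] by (fastforce simp: symp_def)
  show "transp (\<lambda>x y. x - y \<in> (dA :: 'n omega set))"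
  proof (rule transpI)
    fix x y z :: "'n omega"
    assume "x - y \<in> dA" "y - z \<in> dA"
    from omega.subspace_add[OF subspace_dA this] show "x - z \<in> dA" by simp
  qed
qed

instantiation KA :: (finite) ab_group_add
begin

lift_definition zero_KA :: "'a KA" is 0 .

lift_definition plus_KA :: "'a KA \<Rightarrow> 'a KA \<Rightarrow> 'a KA" is "(+)"
  using omega.subspace_add[OF subspace_dA] by (fastforce simp: algebra_simps)

lift_definition uminus_KA :: "'a KA \<Rightarrow> 'a KA" is uminus
  using omega.subspace_neg[OF subspace_dA] by fastforce

lift_definition minus_KA :: "'a KA \<Rightarrow> 'a KA \<Rightarrow> 'a KA" is "(-)"
  using omega.subspace_diff[OF subspace_dA] by (fastforce simp: algebra_simps)

instance
  by standard (transfer; simp add: omega.subspace_0[OF subspace_dA] algebra_simps)+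

end

lift_definition KA_scale :: "complex \<Rightarrow> ('n::finite) KA \<Rightarrow> 'n KA" is "pm_scale (*s)"
  by (simp flip: omega.scale_right_diff_distrib add: omega.subspace_scale[OF subspace_dA])

interpretation KA: vector_space "KA_scale :: complex \<Rightarrow> ('n::finite) KA \<Rightarrow> 'n KA"
  by unfold_locales
    (transfer; simp add: omega.subspace_0[OF subspace_dA] omega.scale_right_distrib
      omega.scale_left_distrib)+


lemma abs_KA_eq_iff: "abs_KA v = abs_KA w \<longleftrightarrow> v - w \<in> dA"
  by (rule KA.abs_eq_iff)

lemma abs_KA_add: "abs_KA (v + w) = abs_KA v + abs_KA w"
  by (simp add: plus_KA.abs_eq)

lemma abs_KA_scale: "abs_KA (pm_scale (*s) c w) = KA_scale c (abs_KA w)"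
  by (simp add: KA_scale.abs_eq)

lemma abs_KA_zero: "abs_KA 0 = 0"
  by (simp add: zero_KA_def)

text \<open>\<open>t_omega r j\<close> is \<open>t\<^sup>r K\<^sub>j\<close> in \<open>\<Omega>\<^sub>A\<close>, \<open>tK r j\<close> its class in \<open>\<K>\<^sub>A\<close>, and
  \<open>t_omega_sum q r\<close> is \<open>\<Sum>\<^sub>p q\<^sub>p t\<^sup>r K\<^sub>p\<close> for \<open>q \<in> \<int>\<^sup>n\<close>.\<close>

definition t_omega :: "int ^ 'n \<Rightarrow> 'n::finite \<Rightarrow> 'n omega" where
  "t_omega r j = Poly_Mapping.single r (axis j 1)"

definition t_omega_sum :: "int ^ 'n \<Rightarrow> int ^ 'n \<Rightarrow> ('n::finite) omega" where
  "t_omega_sum q r = (\<Sum>p\<in>UNIV. pm_scale (*s) (of_int (q $ p)) (t_omega r p))"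

definition tK :: "int ^ 'n \<Rightarrow> 'n::finite \<Rightarrow> 'n KA" where
  "tK r j = abs_KA (t_omega r j)"

definition tD :: "int ^ 'n \<Rightarrow> 'n::finite \<Rightarrow> 'n der" where
  "tD r i = Poly_Mapping.single r (axis i 1)"

lemma t_omega_sum_eq: "t_omega_sum q r = Poly_Mapping.single r (cvec q)"
proof (rule poly_mapping_eqI)
  fix k
  have "Poly_Mapping.lookup (t_omega_sum q r) k =
      (\<Sum>p\<in>UNIV. of_int (q $ p) *s (if r = k then axis p 1 else 0))"
    unfolding t_omega_sum_def t_omega_def
    by (simp add: lookup_sum lookup_pm_scale[OF vector_space_vec_scale] lookup_single when_def)
  also have "\<dots> = Poly_Mapping.lookup (Poly_Mapping.single r (cvec q)) k"
    by (auto simp: vec_eq_iff axis_def cvec_def lookup_single when_def if_distrib sum.If_cases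
        cong: if_cong)
  finally show "Poly_Mapping.lookup (t_omega_sum q r) k =
      Poly_Mapping.lookup (Poly_Mapping.single r (cvec q)) k" .
qed

subsection \<open>Derivations\<close>

text \<open>\<open>der_act s D\<close> is \<open>1 \<otimes> D\<close> on \<open>V \<otimes> A\<close>, where \<open>s\<close> is the scalar multiplication of \<open>V\<close>.\<close>

definition der_act ::
  "(complex \<Rightarrow> 'v::comm_monoid_add \<Rightarrow> 'v) \<Rightarrow> ('n::finite) der \<Rightarrow>
   ((int ^ 'n) \<Rightarrow>\<^sub>0 'v) \<Rightarrow> ((int ^ 'n) \<Rightarrow>\<^sub>0 'v)" where
  "der_act s D f =
     lin_ext (\<lambda>r u. lin_ext (\<lambda>q x. Poly_Mapping.single (r + q) (s (dotc u (cvec q)) x)) f) D"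

text \<open>The part of \<open>[D(u,r),D(v,s)]\<close> in \<open>Der(A)\<close>.\<close>

definition der_br :: "('n::finite) der \<Rightarrow> 'n der \<Rightarrow> 'n der" where
  "der_br D E =
     lin_ext (\<lambda>r u. lin_ext (\<lambda>s v.
       Poly_Mapping.single (r + s) (dotc u (cvec s) *s v - dotc v (cvec r) *s u)) E) D"

text \<open>\<open>[t\<^sup>r d\<^sub>i, t\<^sup>s K\<^sub>j]\<close>, as an element of \<open>\<Omega>\<^sub>A\<close>, extended bilinearly and then passed to the
  quotient; that it is compatible with \<open>dA\<close> is the lemma \<open>der_KA_abs\<close>.\<close>

definition tD_omega :: "int ^ 'n \<Rightarrow> 'n::finite \<Rightarrow> int ^ 'n \<Rightarrow> 'n \<Rightarrow> 'n omega" where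
  "tD_omega r i s j = pm_scale (*s) (of_int (s $ i)) (t_omega (r + s) j) +
     (if i = j then t_omega_sum r (r + s) else 0)"

definition der_omega :: "('n::finite) der \<Rightarrow> 'n omega \<Rightarrow> 'n omega" where
  "der_omega D w =
     lin_ext (\<lambda>r u. lin_ext (\<lambda>s v.
       \<Sum>i\<in>UNIV. \<Sum>j\<in>UNIV. pm_scale (*s) (u $ i * v $ j) (tD_omega r i s j)) w) D"

definition der_KA :: "('n::finite) der \<Rightarrow> 'n KA \<Rightarrow> 'n KA" where
  "der_KA D k = abs_KA (der_omega D (rep_KA k))"

definition cocycle1 :: "int ^ 'n \<Rightarrow> 'n::finite \<Rightarrow> int ^ 'n \<Rightarrow> 'n \<Rightarrow> 'n KA" where
  "cocycle1 r i s j = KA_scale (- of_int (s $ i) * of_int (r $ j)) (abs_KA (t_omega_sum r (r + s)))"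

definition cocycle2 :: "int ^ 'n \<Rightarrow> 'n::finite \<Rightarrow> int ^ 'n \<Rightarrow> 'n \<Rightarrow> 'n KA" where
  "cocycle2 r i s j = KA_scale (of_int (r $ i) * of_int (s $ j)) (abs_KA (t_omega_sum r (r + s)))"

definition phi :: "complex \<Rightarrow> complex \<Rightarrow> ('n::finite) der \<Rightarrow> 'n der \<Rightarrow> 'n KA" where
  "phi c1 c2 D E =
     lin_ext (\<lambda>r u. lin_ext (\<lambda>s v.
       \<Sum>i\<in>UNIV. \<Sum>j\<in>UNIV. KA_scale (u $ i * v $ j)
         (KA_scale c1 (cocycle1 r i s j) + KA_scale c2 (cocycle2 r i s j))) E) D"

subsection \<open>The Lie algebra\<close>

type_synonym ('g, 'n) toroidal = "((int ^ 'n) \<Rightarrow>\<^sub>0 'g) \<times> 'n KA \<times> 'n der"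

definition loop_br ::
  "('g \<Rightarrow> 'g \<Rightarrow> 'g) \<Rightarrow> ((int ^ 'n::finite) \<Rightarrow>\<^sub>0 'g::ab_group_add) \<Rightarrow>
   ((int ^ 'n) \<Rightarrow>\<^sub>0 'g) \<Rightarrow> ((int ^ 'n) \<Rightarrow>\<^sub>0 'g)" where
  "loop_br br f g =
     lin_ext (\<lambda>r x. lin_ext (\<lambda>s y. Poly_Mapping.single (r + s) (br x y)) g) f"

definition loop_cocycle ::
  "(complex \<Rightarrow> 'g \<Rightarrow> 'g) \<Rightarrow> ('g \<Rightarrow> 'g \<Rightarrow> 'g) \<Rightarrow> ((int ^ 'n::finite) \<Rightarrow>\<^sub>0 'g::ab_group_add) \<Rightarrow>
   ((int ^ 'n) \<Rightarrow>\<^sub>0 'g) \<Rightarrow> 'n KA" where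
  "loop_cocycle sc br f g =
     lin_ext (\<lambda>r x. lin_ext (\<lambda>s y.
       KA_scale (lie_algebra.killing sc br x y) (abs_KA (t_omega_sum r (r + s)))) g) f"

definition tor_scale ::
  "(complex \<Rightarrow> 'g \<Rightarrow> 'g) \<Rightarrow> complex \<Rightarrow> ('g::ab_group_add, 'n::finite) toroidal \<Rightarrow>
   ('g, 'n) toroidal" where
  "tor_scale sc c = (\<lambda>(f, k, D). (pm_scale sc c f, KA_scale c k, pm_scale (*s) c D))"

definition tor_br ::
  "(complex \<Rightarrow> 'g \<Rightarrow> 'g) \<Rightarrow> ('g \<Rightarrow> 'g \<Rightarrow> 'g) \<Rightarrow> complex \<Rightarrow> complex \<Rightarrow>
   ('g::ab_group_add, 'n::finite) toroidal \<Rightarrow> ('g, 'n) toroidal \<Rightarrow> ('g, 'n) toroidal" where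
  "tor_br sc br c1 c2 = (\<lambda>(f, k, D) (f', k', D').
     (loop_br br f f' + der_act sc D f' - der_act sc D' f,
      loop_cocycle sc br f f' + der_KA D k' - der_KA D' k + phi c1 c2 D D',
      der_br D D'))"

definition loop_elt :: "'g \<Rightarrow> int ^ 'n \<Rightarrow> ('g::ab_group_add, 'n::finite) toroidal" where
  "loop_elt x r = (Poly_Mapping.single r x, 0, 0)"

definition K_elt :: "int ^ 'n \<Rightarrow> 'n \<Rightarrow> ('g::ab_group_add, 'n::finite) toroidal" where
  "K_elt r j = (0, tK r j, 0)"

definition D_elt :: "int ^ 'n \<Rightarrow> 'n \<Rightarrow> ('g::ab_group_add, 'n::finite) toroidal" where
  "D_elt r j = (0, 0, tD r j)"

section \<open>Polynomials\<close>

type_synonym 'v mpol = "('v \<Rightarrow>\<^sub>0 nat) \<Rightarrow>\<^sub>0 complex"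

definition Cst :: "complex \<Rightarrow> 'v mpol" where
  "Cst c = Poly_Mapping.single 0 c"

definition Var :: "'v \<Rightarrow> 'v mpol" where
  "Var v = Poly_Mapping.single (Poly_Mapping.single v 1) 1"

definition mscale :: "complex \<Rightarrow> 'v mpol \<Rightarrow> 'v mpol" where
  "mscale c p = Cst c * p"

definition subst :: "('v::finite \<Rightarrow> 'w mpol) \<Rightarrow> 'v mpol \<Rightarrow> 'w mpol" where
  "subst \<theta> p = lin_ext (\<lambda>m c. Cst c * (\<Prod>v\<in>UNIV. \<theta> v ^ Poly_Mapping.lookup m v)) p"

text \<open>\<open>U(\<hh>)\<close> is \<open>'l mpol\<close> with \<open>H\<^sub>i = Var i\<close>; \<open>U(\<hh> \<oplus> D)\<close> is \<open>('l + 'n) mpol\<close> with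
  \<open>H\<^sub>i = Var (Inl i)\<close> and \<open>d\<^sub>j = Var (Inr j)\<close>.\<close>

definition embed_h :: "('l::finite) mpol \<Rightarrow> ('l + 'n) mpol" where
  "embed_h = subst (\<lambda>i. Var (Inl i))"

definition sigma :: "'l::finite \<Rightarrow> ('l + 'n::finite) mpol \<Rightarrow> ('l + 'n) mpol" where
  "sigma i = subst (\<lambda>v. if v = Inl i then Var v - 1 else Var v)"

definition tau :: "'n::finite \<Rightarrow> ('l::finite + 'n) mpol \<Rightarrow> ('l + 'n) mpol" where
  "tau j = subst (\<lambda>v. if v = Inr j then Var v - 1 else Var v)"

text \<open>\<open>\<tau>\<^sup>r = \<tau>\<^sub>1\<^bsup>r\<^sub>1\<^esup> \<cdots> \<tau>\<^sub>n\<^bsup>r\<^sub>n\<^esup>\<close>, the automorphism \<open>d\<^sub>j \<mapsto> d\<^sub>j - r\<^sub>j\<close>; by \<open>tau_pow_add\<close> and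
  \<open>tau_pow_axis\<close> below it is the homomorphism \<open>\<int>\<^sup>n \<rightarrow> Aut\<close> with \<open>e\<^sub>j \<mapsto> \<tau>\<^sub>j\<close>.\<close>

definition tau_pow :: "int ^ 'n \<Rightarrow> ('l::finite + 'n::finite) mpol \<Rightarrow> ('l + 'n) mpol" where
  "tau_pow r = subst (\<lambda>v. case v of Inl i \<Rightarrow> Var v | Inr j \<Rightarrow> Var v - of_int (r $ j))"

definition lam_pow :: "complex ^ 'n \<Rightarrow> int ^ 'n::finite \<Rightarrow> complex" where
  "lam_pow \<Lambda> r = (\<Prod>j\<in>UNIV. (\<Lambda> $ j) powi (r $ j))"

section \<open>The modules\<close>

text \<open>The objects of \<open>\<M>(\<gg>,\<hh>)\<close>, identified with \<open>U(\<hh>)\<close> on which \<open>\<hh>\<close> acts by multiplication.\<close>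

definition M_cat ::
  "(complex \<Rightarrow> 'g::ab_group_add \<Rightarrow> 'g) \<Rightarrow> ('g \<Rightarrow> 'g \<Rightarrow> 'g) \<Rightarrow> ('l::finite \<Rightarrow> 'g) \<Rightarrow>
   ('g \<Rightarrow> 'l mpol \<Rightarrow> 'l mpol) \<Rightarrow> bool" where
  "M_cat sc br H \<rho> \<longleftrightarrow>
     lie_module sc br mscale \<rho> \<and>
     (\<forall>c f. \<rho> (\<Sum>i\<in>UNIV. sc (c i) (H i)) f = (\<Sum>i\<in>UNIV. mscale (c i) (Var i)) * f)"

definition is_M_hat ::
  "(complex \<Rightarrow> 'g::ab_group_add \<Rightarrow> 'g) \<Rightarrow> ('g \<Rightarrow> 'g \<Rightarrow> 'g) \<Rightarrow> complex \<Rightarrow> complex \<Rightarrow>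
   ('l::finite \<Rightarrow> 'g) \<Rightarrow> ('l \<Rightarrow> 'g) \<Rightarrow> ('l \<Rightarrow> 'g) \<Rightarrow>
   complex ^ 'n::finite \<Rightarrow> complex \<Rightarrow> ('g \<Rightarrow> 'l mpol \<Rightarrow> 'l mpol) \<Rightarrow>
   (('g, 'n) toroidal \<Rightarrow> ('l + 'n) mpol \<Rightarrow> ('l + 'n) mpol) \<Rightarrow> bool" where
  "is_M_hat sc br c1 c2 x y H \<Lambda> a \<rho> act \<longleftrightarrow>
     lie_module (tor_scale sc) (tor_br sc br c1 c2) mscale act \<and>
     (\<forall>g r.
       (\<forall>j. act (K_elt r j) g = 0) \<and>
       (\<forall>c. act (loop_elt (\<Sum>i\<in>UNIV. sc (c i) (H i)) r) g =
          mscale (lam_pow \<Lambda> r) ((\<Sum>i\<in>UNIV. mscale (c i) (Var (Inl i))) * tau_pow r g)) \<and>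
       (\<forall>i. act (loop_elt (x i) r) g =
          mscale (lam_pow \<Lambda> r) (sigma i (tau_pow r g) * embed_h (\<rho> (x i) 1))) \<and>
       (\<forall>i. act (loop_elt (y i) r) g =
          mscale (lam_pow \<Lambda> r) (inv (sigma i) (tau_pow r g) * embed_h (\<rho> (y i) 1))) \<and>
       (\<forall>j. act (D_elt r j) g =
          mscale (lam_pow \<Lambda> r) (tau_pow r g * (Var (Inr j) - Cst (of_int (r $ j) * (a + 1))))))"

text \<open>The action is prescribed on elements that generate the toroidal Lie algebra but do not span
  it; by \<open>M_hat_unique_existence\<close> there is exactly one module structure extending it.\<close>

definition M_hat ::
  "(complex \<Rightarrow> 'g::ab_group_add \<Rightarrow> 'g) \<Rightarrow> ('g \<Rightarrow> 'g \<Rightarrow> 'g) \<Rightarrow> complex \<Rightarrow> complex \<Rightarrow>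
   ('l::finite \<Rightarrow> 'g) \<Rightarrow> ('l \<Rightarrow> 'g) \<Rightarrow> ('l \<Rightarrow> 'g) \<Rightarrow>
   complex ^ 'n::finite \<Rightarrow> complex \<Rightarrow> ('g \<Rightarrow> 'l mpol \<Rightarrow> 'l mpol) \<Rightarrow>
   ('g, 'n) toroidal \<Rightarrow> ('l + 'n) mpol \<Rightarrow> ('l + 'n) mpol" where
  "M_hat sc br c1 c2 x y H \<Lambda> a \<rho> = (THE act. is_M_hat sc br c1 c2 x y H \<Lambda> a \<rho> act)"

section \<open>Existence and uniqueness of the module\<close>

subsection \<open>Substitution homomorphisms\<close>

lemma Cst_0 [simp]: "Cst 0 = 0" and Cst_1 [simp]: "Cst 1 = 1"
  by (simp_all add: Cst_def)

lemma Cst_add: "Cst (c + d) = Cst c + Cst d"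
  by (simp add: Cst_def single_add)

lemma Cst_minus: "Cst (- c) = - Cst c"
  by (simp add: Cst_def single_uminus)

lemma Cst_mult: "Cst (c * d) = Cst c * Cst d"
  by (simp add: Cst_def mult_single)

lemma Cst_of_int: "Cst (of_int k) = of_int k"
  by (simp add: Cst_def)

lemma subst_add: "subst \<theta> (p + q) = subst \<theta> p + subst \<theta> q"
  unfolding subst_def by (intro lin_ext_add) (auto simp: Cst_add algebra_simps)

lemma subst_zero [simp]: "subst \<theta> 0 = 0"
  by (simp add: subst_def)

lemma subst_single:
  "subst \<theta> (Poly_Mapping.single m c) = Cst c * (\<Prod>v\<in>UNIV. \<theta> v ^ Poly_Mapping.lookup m v)"
  unfolding subst_def by (subst lin_ext_single) auto

lemma subst_Cst [simp]: "subst \<theta> (Cst c) = Cst c"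
  unfolding Cst_def[of c] subst_single by (simp add: Cst_def)

lemma subst_one [simp]: "subst \<theta> 1 = 1"
  using subst_Cst[of \<theta> 1] by simp

lemma subst_mult: "subst \<theta> (p * q) = subst \<theta> p * subst \<theta> q"
proof (rule additive_pm_eqI[where p = p])
  fix m c
  show "subst \<theta> (Poly_Mapping.single m c * q) = subst \<theta> (Poly_Mapping.single m c) * subst \<theta> q"
    by (rule additive_pm_eqI[where p = q])
      (auto simp: subst_add algebra_simps mult_single subst_single lookup_add power_add Cst_mult
        prod.distrib)
qed (auto simp: subst_add algebra_simps)

lemma subst_Var [simp]: "subst \<theta> (Var v) = \<theta> v"
proof -
  have "(\<Prod>w\<in>UNIV. \<theta> w ^ Poly_Mapping.lookup (Poly_Mapping.single v 1) w) =
      (\<Prod>w\<in>{v}. \<theta> w ^ Poly_Mapping.lookup (Poly_Mapping.single v (1::nat)) w)"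
    by (rule prod.mono_neutral_right) (auto simp: lookup_single when_def)
  then show ?thesis unfolding Var_def subst_single by simp
qed

lemma subst_minus: "subst \<theta> (- p) = - subst \<theta> p"
  using subst_add[of \<theta> p "- p"] by (simp add: eq_neg_iff_add_eq_0 add.commute)

lemma subst_diff: "subst \<theta> (p - q) = subst \<theta> p - subst \<theta> q"
  using subst_add[of \<theta> p "- q"] by (simp add: subst_minus)

lemma subst_power: "subst \<theta> (p ^ k) = subst \<theta> p ^ k"
  by (induction k) (auto simp: subst_mult)

lemma subst_prod: "subst \<theta> (prod f A) = (\<Prod>a\<in>A. subst \<theta> (f a))"
  by (induction A rule: infinite_finite_induct) (auto simp: subst_mult)

lemma subst_sum: "subst \<theta> (sum f A) = (\<Sum>a\<in>A. subst \<theta> (f a))"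
  by (induction A rule: infinite_finite_induct) (auto simp: subst_add)

lemma subst_of_int [simp]: "subst \<theta> (of_int k) = of_int k"
  using subst_Cst[of \<theta> "of_int k"] by (simp add: Cst_of_int)

lemma subst_mscale: "subst \<theta> (mscale c p) = mscale c (subst \<theta> p)"
  by (simp add: mscale_def subst_mult)

lemma single_eq_prod_Var:
  "Poly_Mapping.single m c = Cst c * (\<Prod>v\<in>UNIV. Var v ^ Poly_Mapping.lookup m (v::'v::finite))"
proof -
  have "(\<Prod>v\<in>UNIV. Var v ^ Poly_Mapping.lookup m v) = Poly_Mapping.single m (1::complex)"
  proof (induction m rule: pm_induct)
    case (add m v k)
    have pow: "Var v ^ k = Poly_Mapping.single (Poly_Mapping.single v k) 1" for k :: nat
      by (induction k) (auto simp: Var_def mult_single simp flip: single_add)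
    have "(\<Prod>w\<in>UNIV. Var w ^ Poly_Mapping.lookup (Poly_Mapping.single v k) w) =
      (\<Prod>w\<in>{v}. Var w ^ Poly_Mapping.lookup (Poly_Mapping.single v k) w)"
      by (rule prod.mono_neutral_right) (auto simp: lookup_single when_def)
    then have "(\<Prod>w\<in>UNIV. Var w ^ Poly_Mapping.lookup (Poly_Mapping.single v k) w) =
      Poly_Mapping.single (Poly_Mapping.single v k) 1"
      by (simp add: pow)
    then show ?case using add by (simp add: lookup_add power_add prod.distrib mult_single)
  qed simp
  then show ?thesis by (simp add: Cst_def mult_single)
qed

lemma mpol_induct [case_names Cst add Var]:
  assumes "\<And>c. P (Cst c)" "\<And>p q. P p \<Longrightarrow> P q \<Longrightarrow> P (p + q)" "\<And>v p. P p \<Longrightarrow> P (Var v * p)"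
  shows "P (p :: ('v::finite) mpol)"
proof (induction p rule: pm_induct)
  case zero
  show ?case using assms(1)[of 0] by simp
next
  case (add p m c)
  have pow: "P (Var v ^ k * q)" if "P q" for v k q
    by (induction k) (use that assms(3) in \<open>auto simp: mult.assoc\<close>)
  have "finite A \<Longrightarrow> P ((\<Prod>v\<in>A. Var v ^ Poly_Mapping.lookup m v) * Cst c)" for A
    by (induction rule: finite_induct) (auto simp: assms(1) mult.assoc pow)
  from this[of UNIV] have "P (Poly_Mapping.single m c)"
    by (simp add: single_eq_prod_Var[of m c] mult.commute)
  with add assms(2) show ?case by blast
qed

lemma subst_subst: "subst \<theta>' (subst \<theta> p) = subst (\<lambda>v. subst \<theta>' (\<theta> v)) p"
  by (induction p rule: mpol_induct) (auto simp: subst_add subst_mult)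

lemma subst_id [simp]: "subst Var p = p"
  by (induction p rule: mpol_induct) (auto simp: subst_add subst_mult)

lemma sigma_comp:
  "sigma i \<circ> subst (\<lambda>v. if v = Inl i then Var v + 1 else Var v) = id"
  "subst (\<lambda>v. if v = Inl i then Var v + 1 else Var v) \<circ> sigma i = id"
proof -
  have *: "(\<lambda>v. subst (\<lambda>v. if v = Inl i then Var v - 1 else Var v)
      (if v = Inl i then Var v + 1 else Var v)) = Var"
    "(\<lambda>v. subst (\<lambda>v. if v = Inl i then Var v + 1 else Var v)
      (if v = Inl i then Var v - 1 else Var v)) = Var"
    by (auto simp: fun_eq_iff subst_add subst_diff)
  show "sigma i \<circ> subst (\<lambda>v. if v = Inl i then Var v + 1 else Var v) = id"
    "subst (\<lambda>v. if v = Inl i then Var v + 1 else Var v) \<circ> sigma i = id"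
    by (auto simp: fun_eq_iff sigma_def subst_subst *)
qed

lemma inv_sigma: "inv (sigma i) = subst (\<lambda>v. if v = Inl i then Var v + 1 else Var v)"
  by (rule inv_unique_comp[OF sigma_comp])

lemma bij_sigma: "bij (sigma i)"
  by (rule o_bij[OF sigma_comp(2) sigma_comp(1)])

lemma tau_pow_zero: "tau_pow 0 = id"
proof -
  have "(\<lambda>v. case v of Inl i \<Rightarrow> Var v | Inr j \<Rightarrow> Var v - of_int ((0 :: int ^ 'b) $ j)) =
      (Var :: 'a + 'b \<Rightarrow> _)"
    by (auto simp: fun_eq_iff split: sum.split)
  then show ?thesis by (auto simp: tau_pow_def fun_eq_iff)
qed

lemma tau_pow_add: "tau_pow (r + s) g = tau_pow r (tau_pow s g)"
  unfolding tau_pow_def subst_subst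
  by (rule arg_cong[where f = "\<lambda>\<theta>. subst \<theta> g"])
    (auto simp: fun_eq_iff subst_diff split: sum.split)

lemma tau_pow_axis: "tau_pow (axis j 1) = tau j"
  unfolding tau_pow_def tau_def
  by (rule arg_cong[where f = subst]) (auto simp: fun_eq_iff axis_def split: sum.split)

lemma bij_tau: "bij (tau j)"
proof (rule o_bij)
  show "tau j \<circ> tau_pow (- axis j 1) = id" "tau_pow (- axis j 1) \<circ> tau j = id"
    by (auto simp: fun_eq_iff tau_pow_zero simp flip: tau_pow_axis tau_pow_add)
qed

lemma vector_space_mscale: "vector_space (mscale :: complex \<Rightarrow> 'v mpol \<Rightarrow> 'v mpol)"
  by unfold_locales (auto simp: mscale_def Cst_add Cst_mult algebra_simps)

lemma linear_mscaleI:
  fixes f :: "'a::ab_group_add \<Rightarrow> 'b mpol"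
  assumes "vector_space s" "\<And>u v. f (u + v) = f u + f v" "\<And>c v. f (s c v) = mscale c (f v)"
  shows "Vector_Spaces.linear s mscale f"
proof -
  interpret s: vector_space s by fact
  interpret t: vector_space "mscale :: complex \<Rightarrow> 'b mpol \<Rightarrow> 'b mpol" by (rule vector_space_mscale)
  show ?thesis by unfold_locales (auto simp: assms)
qed

subsection \<open>The structure maps of the toroidal Lie algebra\<close>

lemma cvec_add: "cvec (r + s) = cvec r + cvec s"
  by (simp add: cvec_def vec_eq_iff)

lemma dotc_add_left: "dotc (u + v) w = dotc u w + dotc v w"
  by (simp add: dotc_def algebra_simps sum.distrib)

lemma dotc_add_right: "dotc w (u + v) = dotc w u + dotc w v"
  by (simp add: dotc_def algebra_simps sum.distrib)

lemma dotc_scale_left: "dotc (c *s u) v = c * dotc u v"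
  by (simp add: dotc_def sum_distrib_left algebra_simps)

lemma dotc_scale_right: "dotc u (c *s v) = c * dotc u v"
  by (simp add: dotc_def sum_distrib_left algebra_simps)

lemma dotc_0 [simp]: "dotc 0 v = 0" "dotc v 0 = 0"
  by (simp_all add: dotc_def)

lemma dotc_diff_left: "dotc (u - v) w = dotc u w - dotc v w"
  by (simp add: dotc_def algebra_simps sum_subtractf)

lemma dotc_axis: "dotc (axis i 1) v = v $ i"
  by (simp add: dotc_def axis_def if_distrib[of "\<lambda>x. x * _"] cong: if_cong)

lemma lin_ext_add_fun:
  assumes "\<And>k u. b k u = b1 k u + b2 k u"
  shows "lin_ext b p = lin_ext b1 p + lin_ext b2 p"
  by (simp add: lin_ext_def assms sum.distrib)

lemma lin_ext_zero_fun: "(\<And>k u. b k u = 0) \<Longrightarrow> lin_ext b p = 0"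
  by (simp add: lin_ext_def)

text \<open>Biadditive extension of a family of biadditive maps.\<close>

locale biadditive =
  fixes b :: "'k \<Rightarrow> 'a::comm_monoid_add \<Rightarrow> 'm \<Rightarrow> 'b::comm_monoid_add \<Rightarrow> 'c::ab_group_add"
  assumes left: "b r (u + u') s v = b r u s v + b r u' s v"
    and right: "b r u s (v + v') = b r u s v + b r u s v'"
begin

lemma zero_left: "b r 0 s v = 0"
  using left[of r 0 0 s v] by simp

lemma zero_right: "b r u s 0 = 0"
  using right[of r u s 0 0] by simp

lemma ext_left:
  "lin_ext (\<lambda>r u. lin_ext (b r u) q) (p + p') =
    lin_ext (\<lambda>r u. lin_ext (b r u) q) p + lin_ext (\<lambda>r u. lin_ext (b r u) q) p'"
  by (intro lin_ext_add lin_ext_add_fun lin_ext_zero_fun left zero_left)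

lemma ext_right:
  "lin_ext (\<lambda>r u. lin_ext (b r u) (q + q')) p =
    lin_ext (\<lambda>r u. lin_ext (b r u) q) p + lin_ext (\<lambda>r u. lin_ext (b r u) q') p"
  by (intro lin_ext_add lin_ext_add_fun right zero_right)

lemma ext_single:
  "lin_ext (\<lambda>r u. lin_ext (b r u) (Poly_Mapping.single s v)) (Poly_Mapping.single r u) = b r u s v"
  by (simp add: lin_ext_single zero_left zero_right)

end

lemma linear_addD: "Vector_Spaces.linear s t f \<Longrightarrow> f (u + v) = f u + f v"
  unfolding Vector_Spaces.linear_def by (blast intro: module_hom.add)

lemma linear_scaleD: "Vector_Spaces.linear s t f \<Longrightarrow> f (s c v) = t c (f v)"
  unfolding Vector_Spaces.linear_def by (blast intro: module_hom.scale)

lemma biadditive_der_br: "biadditive (\<lambda>r u s v.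
    Poly_Mapping.single (r + s) (dotc u (cvec s) *s v - dotc v (cvec r) *s u))"
  by unfold_locales
    (simp_all add: dotc_add_left single_add[symmetric] vec_eq_iff algebra_simps)

lemma biadditive_der_omega:
  "biadditive (\<lambda>r u s v. \<Sum>i\<in>UNIV. \<Sum>j\<in>UNIV. pm_scale (*s) (u $ i * v $ j) (tD_omega r i s j))"
  by unfold_locales (simp_all add: algebra_simps omega.scale_left_distrib sum.distrib)

lemmas der_omega_add_left = biadditive.ext_left[OF biadditive_der_omega, folded der_omega_def]
lemmas der_omega_add_right = biadditive.ext_right[OF biadditive_der_omega, folded der_omega_def]

lemma sum_single: "(\<Sum>i\<in>A. Poly_Mapping.single k (f i)) = Poly_Mapping.single k (sum f A)"
  by (induction A rule: infinite_finite_induct) (auto simp: single_add)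

lemma der_omega_single:
  "der_omega (Poly_Mapping.single r u) (Poly_Mapping.single s v) =
    Poly_Mapping.single (r + s) (dotc u (cvec s) *s v + dotc u v *s cvec r)"
  (is "_ = Poly_Mapping.single _ ?w")
proof -
  have "der_omega (Poly_Mapping.single r u) (Poly_Mapping.single s v) =
      (\<Sum>i\<in>UNIV. \<Sum>j\<in>UNIV. pm_scale (*s) (u $ i * v $ j) (tD_omega r i s j))"
    unfolding der_omega_def by (rule biadditive.ext_single[OF biadditive_der_omega])
  also have "\<dots> = (\<Sum>i\<in>UNIV. \<Sum>j\<in>UNIV. Poly_Mapping.single (r + s)
      ((u $ i * v $ j) *s (of_int (s $ i) *s axis j 1 + (if i = j then cvec r else 0))))"
    by (intro sum.cong refl)
      (simp add: tD_omega_def t_omega_def t_omega_sum_eq pm_scale_single[OF vector_space_vec_scale]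
         flip: single_add)
  also have "\<dots> = Poly_Mapping.single (r + s) (\<Sum>i\<in>UNIV. \<Sum>j\<in>UNIV.
      (u $ i * v $ j) *s (of_int (s $ i) *s axis j 1 + (if i = j then cvec r else 0)))"
    by (simp only: sum_single)
  also have "(\<Sum>i\<in>UNIV. \<Sum>j\<in>UNIV.
      (u $ i * v $ j) *s (of_int (s $ i) *s axis j 1 + (if i = j then cvec r else 0))) = ?w"
  proof -
    have "(\<Sum>i\<in>UNIV. \<Sum>j\<in>UNIV. u $ i * v $ j * (of_int (s $ i) * axis j 1 $ p)) =
        (\<Sum>i\<in>UNIV. u $ i * of_int (s $ i)) * v $ p" for p
      by (simp add: axis_def if_distrib sum_distrib_right sum_distrib_left algebra_simps
          cong: if_cong)
    moreover have "(\<Sum>i\<in>UNIV. \<Sum>j\<in>UNIV.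
        (u $ i * v $ j) *s (of_int (s $ i) *s axis j 1 + (if i = j then cvec r else 0))) $ p =
        (\<Sum>i\<in>UNIV. \<Sum>j\<in>UNIV. u $ i * v $ j * (of_int (s $ i) * axis j 1 $ p)) +
        (\<Sum>i\<in>UNIV. \<Sum>j\<in>UNIV. if i = j then u $ i * v $ j * cvec r $ p else 0)" for p
      unfolding sum_component sum.distrib[symmetric]
      by (intro sum.cong refl) (simp add: distrib_left)
    ultimately show ?thesis
      by (simp add: vec_eq_iff dotc_def cvec_def sum_distrib_right)
  qed
  finally show ?thesis .
qed

lemma single_in_dA: "Poly_Mapping.single r (c *s cvec r) \<in> dA"
proof -
  have "Poly_Mapping.single r (cvec r) \<in> dA"
    unfolding dA_def by (rule omega.span_base) simp
  from omega.subspace_scale[OF subspace_dA this, of c] show ?thesis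
    by (simp add: pm_scale_single[OF vector_space_vec_scale])
qed

lemma der_omega_dA:
  assumes "w \<in> dA" shows "der_omega D w \<in> dA"
  using assms[unfolded dA_def]
proof (induction rule: omega.span_induct_alt)
  case base
  have "der_omega D 0 = 0" using der_omega_add_right[of D 0 0] by simp
  then show ?case by (simp add: omega.subspace_0[OF subspace_dA])
next
  case (step c x y)
  then obtain m where m: "pm_scale (*s) c x = Poly_Mapping.single m (c *s cvec m)"
    by (auto simp: pm_scale_single[OF vector_space_vec_scale])
  have "der_omega D (Poly_Mapping.single m (c *s cvec m)) \<in> dA"
  proof (induction D rule: pm_induct)
    case zero
    show ?case by (simp add: der_omega_def omega.subspace_0[OF subspace_dA])
  next
    case (add D r u)
    have "der_omega (Poly_Mapping.single r u) (Poly_Mapping.single m (c *s cvec m)) =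
        Poly_Mapping.single (r + m) ((dotc u (cvec m) * c) *s cvec (r + m))"
      by (simp add: der_omega_single cvec_add dotc_scale_right vec_eq_iff algebra_simps)
    then show ?case
      using add by (simp add: der_omega_add_left omega.subspace_add[OF subspace_dA] single_in_dA)
  qed
  then show ?case
    using step by (simp add: m der_omega_add_right omega.subspace_add[OF subspace_dA])
qed

lemma der_KA_abs: "der_KA D (abs_KA w) = abs_KA (der_omega D w)"
proof -
  have "abs_KA (rep_KA (abs_KA w)) = abs_KA w"
    by (rule Quotient3_abs_rep[OF Quotient3_KA])
  then have "rep_KA (abs_KA w) - w \<in> dA" by (simp add: abs_KA_eq_iff)
  from der_omega_dA[OF this, of D]
  have "der_omega D (rep_KA (abs_KA w)) - der_omega D w \<in> dA"
    using der_omega_add_right[of D "rep_KA (abs_KA w) - w" w] by (simp add: algebra_simps)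
  then show ?thesis by (simp add: der_KA_def abs_KA_eq_iff)
qed

lemma vector_space_tor:
  assumes "vector_space sc"
  shows "vector_space (tor_scale sc :: complex \<Rightarrow> ('g::ab_group_add, 'n::finite) toroidal \<Rightarrow> _)"
proof -
  interpret s: vector_space "pm_scale sc :: complex \<Rightarrow> ((int ^ 'n) \<Rightarrow>\<^sub>0 'g) \<Rightarrow> _"
    by (rule vector_space_pm_scale[OF assms])
  show ?thesis
    by unfold_locales
      (auto simp: tor_scale_def s.scale_right_distrib s.scale_left_distrib
        omega.scale_right_distrib omega.scale_left_distrib
        KA.scale_right_distrib KA.scale_left_distrib)
qed

lemma vec_expansion: "(\<Sum>j\<in>UNIV. v $ j *s axis j 1) = (v :: complex ^ 'n::finite)"
  by (simp add: vec_eq_iff axis_def if_distrib cong: if_cong)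

lemma KA_induct [case_names zero add]:
  assumes "P 0" "\<And>k c r j. P k \<Longrightarrow> P (k + KA_scale c (tK r j))"
  shows "P (k :: ('n::finite) KA)"
proof -
  have *: "P (abs_KA w)" for w :: "'n omega"
  proof (induction w rule: pm_induct)
    case zero
    show ?case using assms(1) by (simp add: abs_KA_zero)
  next
    case (add w r v)
    have v: "Poly_Mapping.single r v = (\<Sum>j\<in>UNIV. pm_scale (*s) (v $ j) (t_omega r j))"
    proof -
      show ?thesis
        by (simp add: t_omega_def pm_scale_single[OF vector_space_vec_scale] sum_single
            vec_expansion)
    qed
    have "finite A \<Longrightarrow> P (abs_KA (w + (\<Sum>j\<in>A. pm_scale (*s) (v $ j) (t_omega r j))))" for A
    proof (induction rule: finite_induct)
      case (insert j A)
      from assms(2)[OF insert(3), of "v $ j" r j] insert show ?case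
        by (simp add: tK_def abs_KA_add abs_KA_scale algebra_simps)
    qed (use add in simp)
    from this[of UNIV] show ?case by (simp add: v)
  qed
  have "abs_KA (rep_KA k) = k" by (rule Quotient3_abs_rep[OF Quotient3_KA])
  with *[of "rep_KA k"] show ?thesis by simp
qed

subsection \<open>Coordinates of derivations\<close>

text \<open>\<open>D \<mapsto> der_act (*) D\<close> identifies the coordinate space \<open>'n der\<close> with the derivations of \<open>A\<close>,
  and \<open>der_br\<close> with the commutator.\<close>

definition derivation :: "(((int ^ 'n::finite) \<Rightarrow>\<^sub>0 complex) \<Rightarrow> ((int ^ 'n) \<Rightarrow>\<^sub>0 complex)) \<Rightarrow> bool" where
  "derivation \<delta> \<longleftrightarrow> Vector_Spaces.linear (pm_scale (*)) (pm_scale (*)) \<delta> \<and>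
     (\<forall>f g. \<delta> (f * g) = \<delta> f * g + f * \<delta> g)"

lemma biadditive_der_act_complex:
  "biadditive (\<lambda>r u q z. Poly_Mapping.single (r + q) (dotc u (cvec q) * (z::complex)))"
  by unfold_locales (simp_all add: algebra_simps dotc_add_left single_add)

lemmas der_act_complex_add_left =
  biadditive.ext_left[OF biadditive_der_act_complex, folded der_act_def]
lemmas der_act_complex_add_right =
  biadditive.ext_right[OF biadditive_der_act_complex, folded der_act_def]
lemmas der_act_complex_single =
  biadditive.ext_single[OF biadditive_der_act_complex, folded der_act_def]

lemma der_act_tD:
  "der_act (*) (tD r i) (Poly_Mapping.single s c) = Poly_Mapping.single (r + s) (of_int (s $ i) * c)"
  by (simp add: tD_def der_act_complex_single dotc_axis cvec_def)

lemma pm_scale_complex: "pm_scale (*) c f = Poly_Mapping.single 0 c * f"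
  by (simp add: pm_scale_def mult_map_scale_conv_mult)

lemma derivation_der_act: "derivation (der_act (*) D)"
proof -
  interpret A: vector_space "pm_scale (*) :: complex \<Rightarrow> ((int ^ 'a) \<Rightarrow>\<^sub>0 complex) \<Rightarrow> _"
    by (rule vector_space_pm_scale[OF vector_space_complex])
  have mult: "der_act (*) D (f * g) = der_act (*) D f * g + f * der_act (*) D g" for f g
  proof (rule additive_pm_eqI[where p = D])
    fix r u
    show "der_act (*) (Poly_Mapping.single r u) (f * g) =
        der_act (*) (Poly_Mapping.single r u) f * g + f * der_act (*) (Poly_Mapping.single r u) g"
    proof (rule additive_pm_eqI[where p = f])
      fix p and a :: complex
      show "der_act (*) (Poly_Mapping.single r u) (Poly_Mapping.single p a * g) =
          der_act (*) (Poly_Mapping.single r u) (Poly_Mapping.single p a) * g +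
          Poly_Mapping.single p a * der_act (*) (Poly_Mapping.single r u) g"
      proof (rule additive_pm_eqI[where p = g])
        fix q and b :: complex
        show "der_act (*) (Poly_Mapping.single r u) (Poly_Mapping.single p a * Poly_Mapping.single q b) =
            der_act (*) (Poly_Mapping.single r u) (Poly_Mapping.single p a) * Poly_Mapping.single q b +
            Poly_Mapping.single p a * der_act (*) (Poly_Mapping.single r u) (Poly_Mapping.single q b)"
          by (simp add: mult_single der_act_complex_single cvec_add dotc_add_right add.assoc
              add.left_commute[of p r] algebra_simps flip: single_add)
      qed (simp_all add: der_act_complex_add_right algebra_simps)
    qed (simp_all add: der_act_complex_add_right algebra_simps)
  qed (simp_all add: der_act_complex_add_left algebra_simps)
  have "der_act (*) D (Poly_Mapping.single 0 c) = 0" for c :: complex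
    by (rule additive_pm_eqI[where p = D and g = "\<lambda>_. 0"])
      (simp_all add: der_act_complex_add_left der_act_complex_single cvec_def dotc_def)
  then have "Vector_Spaces.linear (pm_scale (*)) (pm_scale (*)) (der_act (*) D)"
    by unfold_locales (simp_all add: der_act_complex_add_right pm_scale_complex mult)
  with mult show ?thesis by (simp add: derivation_def)
qed

lemma lookup_der_act:
  "Poly_Mapping.lookup (der_act (*) D (Poly_Mapping.single (axis i 1) (1::complex))) (k + axis i 1) =
    Poly_Mapping.lookup D k $ i"
  by (rule additive_pm_eqI[where p = D])
    (auto simp: der_act_complex_add_left der_act_complex_single lookup_add lookup_single when_def
      cvec_def dotc_def axis_def if_distrib[of of_int] if_distrib[of "\<lambda>x. _ * x"] cong: if_cong)

lemma derivation_eqI: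
  fixes \<delta> \<epsilon> :: "((int ^ 'n::finite) \<Rightarrow>\<^sub>0 complex) \<Rightarrow> ((int ^ 'n) \<Rightarrow>\<^sub>0 complex)"
  assumes "derivation \<delta>" "derivation \<epsilon>"
    and eq: "\<And>i. \<delta> (Poly_Mapping.single (axis i 1) 1) = \<epsilon> (Poly_Mapping.single (axis i 1) 1)"
  shows "\<delta> = \<epsilon>"
proof -
  have add: "\<delta> (f + g) = \<delta> f + \<delta> g" "\<epsilon> (f + g) = \<epsilon> f + \<epsilon> g"
    and scl: "\<delta> (pm_scale (*) c f) = pm_scale (*) c (\<delta> f)" "\<epsilon> (pm_scale (*) c f) = pm_scale (*) c (\<epsilon> f)"
    and mult: "\<delta> (f * g) = \<delta> f * g + f * \<delta> g" "\<epsilon> (f * g) = \<epsilon> f * g + f * \<epsilon> g" for f g c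
    using assms linear_addD linear_scaleD unfolding derivation_def by metis+
  define t where "t m = Poly_Mapping.single m (1::complex)" for m :: "int ^ 'n"
  have t_add: "t (m + m') = t m * t m'" for m m' by (simp add: t_def mult_single)
  define S where "S = {m. \<delta> (t m) = \<epsilon> (t m)}"
  have one: "\<delta> 1 = 0" "\<epsilon> 1 = 0" using mult[of 1 1] by simp_all
  then have S0: "0 \<in> S" by (simp add: S_def t_def)
  have S_add: "m + m' \<in> S" if "m \<in> S" "m' \<in> S" for m m'
    using that by (simp add: S_def t_add mult)
  have S_neg: "- m \<in> S" if "m \<in> S" for m
  proof -
    have t1: "t m * t (- m) = 1" by (simp add: t_def mult_single)
    have "\<delta> (t m) * t (- m) + t m * \<delta> (t (- m)) = 0"
      "\<epsilon> (t m) * t (- m) + t m * \<epsilon> (t (- m)) = 0"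
      by (simp_all add: t1 one flip: mult)
    moreover have "\<delta> (t m) = \<epsilon> (t m)" using that by (simp add: S_def)
    ultimately have "t m * \<delta> (t (- m)) = t m * \<epsilon> (t (- m))"
      by (simp add: eq_neg_iff_add_eq_0[symmetric] add_eq_0_iff)
    then have "(t m * t (- m)) * \<delta> (t (- m)) = (t m * t (- m)) * \<epsilon> (t (- m))"
      by (simp add: mult.assoc mult.left_commute[of "t m"])
    then show ?thesis by (simp add: t1 S_def)
  qed
  have ax: "axis i 1 \<in> S" for i using eq by (simp add: S_def t_def)
  have S_nat: "axis i (int k) \<in> S" for i k
  proof (induction k)
    case 0
    have "axis i (int 0) = (0 :: int ^ 'n)" by (simp add: axis_def vec_eq_iff)
    with S0 show ?case by (simp only:)
  next
    case (Suc k)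
    have "axis i (int (Suc k)) = axis i 1 + axis i (int k)" by (simp add: axis_def vec_eq_iff)
    with Suc S_add[OF ax] show ?case by (simp only:)
  qed
  have S_int: "axis i k \<in> S" for i and k :: int
  proof (cases k rule: int_cases2)
    case (nonpos n)
    have "axis i k = - axis i (int n)" by (simp add: nonpos axis_def vec_eq_iff)
    with S_neg[OF S_nat] show ?thesis by (simp only:)
  qed (simp add: S_nat)
  have "finite J \<Longrightarrow> (\<Sum>i\<in>J. axis i (m $ i)) \<in> S" for J and m :: "int ^ 'n"
    by (induction rule: finite_induct) (simp_all add: S0 S_add S_int)
  moreover have "(\<Sum>i\<in>UNIV. axis i (m $ i)) = m" for m :: "int ^ 'n"
    by (simp add: vec_eq_iff axis_def)
  ultimately have "m \<in> S" for m by (metis finite)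
  then have t_eq: "\<delta> (t m) = \<epsilon> (t m)" for m by (simp add: S_def)
  have "\<delta> f = \<epsilon> f" for f
  proof (rule additive_pm_eqI[where p = f])
    fix m c
    have "Poly_Mapping.single m c = pm_scale (*) c (t m)"
      by (simp add: pm_scale_complex t_def mult_single)
    then show "\<delta> (Poly_Mapping.single m c) = \<epsilon> (Poly_Mapping.single m c)"
      by (simp only: scl t_eq)
  qed (rule add)+
  then show ?thesis by (rule ext)
qed

theorem bij_betw_der_act:
  "bij_betw (der_act (*) :: ('n::finite) der \<Rightarrow> _) UNIV {\<delta>. derivation \<delta>}"
proof (rule bij_betw_imageI)
  show "inj (der_act (*) :: 'n der \<Rightarrow> ((int ^ 'n) \<Rightarrow>\<^sub>0 complex) \<Rightarrow> _)"
  proof (rule injI)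
    fix D E :: "'n der"
    assume *: "(der_act (*) D :: ((int ^ 'n) \<Rightarrow>\<^sub>0 complex) \<Rightarrow> _) = der_act (*) E"
    show "D = E"
    proof (rule poly_mapping_eqI)
      show "Poly_Mapping.lookup D k = Poly_Mapping.lookup E k" for k
        unfolding vec_eq_iff using lookup_der_act[of D _ k] lookup_der_act[of E _ k] * by simp
    qed
  qed
  show "range (der_act (*) :: 'n der \<Rightarrow> _) = {\<delta>. derivation \<delta>}"
  proof (intro equalityI subsetI)
    fix \<delta> :: "((int ^ 'n) \<Rightarrow>\<^sub>0 complex) \<Rightarrow> ((int ^ 'n) \<Rightarrow>\<^sub>0 complex)"
    assume "\<delta> \<in> {\<delta>. derivation \<delta>}"
    then have \<delta>: "derivation \<delta>" by simp
    define w :: "int ^ 'n \<Rightarrow> complex ^ 'n" where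
      "w k = (\<chi> i. Poly_Mapping.lookup (\<delta> (Poly_Mapping.single (axis i 1) 1)) (k + axis i 1))" for k
    have "{k. w k \<noteq> 0} \<subseteq>
        (\<Union>i. (\<lambda>k. k - axis i 1) ` Poly_Mapping.keys (\<delta> (Poly_Mapping.single (axis i 1) 1)))"
    proof
      fix k assume "k \<in> {k. w k \<noteq> 0}"
      then obtain i where
        "k + axis i 1 \<in> Poly_Mapping.keys (\<delta> (Poly_Mapping.single (axis i 1) 1))"
        by (auto simp: w_def vec_eq_iff in_keys_iff)
      then have "k \<in> (\<lambda>k. k - axis i 1) ` Poly_Mapping.keys (\<delta> (Poly_Mapping.single (axis i 1) 1))"
        by (intro image_eqI[where x = "k + axis i 1"]) simp_all
      then show "k \<in> (\<Union>i. (\<lambda>k. k - axis i 1) `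
          Poly_Mapping.keys (\<delta> (Poly_Mapping.single (axis i 1) 1)))"
        by blast
    qed
    then have fin: "finite {k. w k \<noteq> 0}" by (rule finite_subset) simp
    define D where "D = Abs_poly_mapping w"
    have D: "Poly_Mapping.lookup D = w" unfolding D_def using fin by simp
    have "der_act (*) D (Poly_Mapping.single (axis i 1) 1) = \<delta> (Poly_Mapping.single (axis i 1) 1)" for i
    proof (rule poly_mapping_eqI)
      fix k
      show "Poly_Mapping.lookup (der_act (*) D (Poly_Mapping.single (axis i 1) 1)) k =
          Poly_Mapping.lookup (\<delta> (Poly_Mapping.single (axis i 1) 1)) k"
        using lookup_der_act[of D i "k - axis i 1"] by (simp add: D w_def)
    qed
    from derivation_eqI[OF derivation_der_act \<delta> this] show "\<delta> \<in> range (der_act (*))"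
      by blast
  qed (auto simp: derivation_der_act)
qed

lemma der_act_der_br:
  fixes f :: "(int ^ 'n::finite) \<Rightarrow>\<^sub>0 complex"
  shows "der_act (*) (der_br D E) f =
    der_act (*) D (der_act (*) E f) - der_act (*) E (der_act (*) D f)"
proof (rule additive_pm_eqI[where p = D])
  fix r and u :: "complex ^ 'n"
  show "der_act (*) (der_br (Poly_Mapping.single r u) E) f =
      der_act (*) (Poly_Mapping.single r u) (der_act (*) E f) -
      der_act (*) E (der_act (*) (Poly_Mapping.single r u) f)"
  proof (rule additive_pm_eqI[where p = E])
    fix s and v :: "complex ^ 'n"
    show "der_act (*) (der_br (Poly_Mapping.single r u) (Poly_Mapping.single s v)) f =
        der_act (*) (Poly_Mapping.single r u) (der_act (*) (Poly_Mapping.single s v) f) -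
        der_act (*) (Poly_Mapping.single s v) (der_act (*) (Poly_Mapping.single r u) f)"
      unfolding der_br_def biadditive.ext_single[OF biadditive_der_br]
    proof (rule additive_pm_eqI[where p = f])
      fix q and c :: complex
      have *: "s + (r + q) = r + (s + q)" by simp
      show "der_act (*) (Poly_Mapping.single (r + s) (dotc u (cvec s) *s v - dotc v (cvec r) *s u))
          (Poly_Mapping.single q c) =
        der_act (*) (Poly_Mapping.single r u) (der_act (*) (Poly_Mapping.single s v) (Poly_Mapping.single q c)) -
        der_act (*) (Poly_Mapping.single s v) (der_act (*) (Poly_Mapping.single r u) (Poly_Mapping.single q c))"
        unfolding der_act_complex_single * single_diff[symmetric]
        by (simp add: dotc_diff_left dotc_scale_left cvec_add dotc_add_right algebra_simps)
    qed (simp_all add: der_act_complex_add_right)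
  qed (simp_all add: der_br_def biadditive.ext_right[OF biadditive_der_br]
      der_act_complex_add_left der_act_complex_add_right)
qed (simp_all add: der_br_def biadditive.ext_left[OF biadditive_der_br]
    der_act_complex_add_left der_act_complex_add_right)

subsection \<open>Extending the action from \<open>U(\<hh>)\<close> to \<open>U(\<hh> \<oplus> D)\<close>\<close>

definition d_monom :: "('n \<Rightarrow> nat) \<Rightarrow> ('l::finite + 'n::finite) mpol" where
  "d_monom e = (\<Prod>j\<in>UNIV. Var (Inr j) ^ e j)"

definition ext_act ::
  "('l::finite mpol \<Rightarrow> 'l mpol) \<Rightarrow> ('l + 'n::finite) mpol \<Rightarrow> ('l + 'n) mpol" where
  "ext_act \<rho> g = lin_ext (\<lambda>m c.
     embed_h (\<rho> (Poly_Mapping.single (Poly_Mapping.map_key Inl m) c)) *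
     d_monom (\<lambda>j. Poly_Mapping.lookup m (Inr j))) g"

lemma prod_sum_type:
  "(\<Prod>v\<in>UNIV. f (v :: 'l::finite + 'n::finite)) = (\<Prod>i\<in>UNIV. f (Inl i)) * (\<Prod>j\<in>UNIV. f (Inr j))"
  by (simp add: prod.Plus flip: UNIV_Plus_UNIV)

lemma lookup_map_key_Inl: "Poly_Mapping.lookup (Poly_Mapping.map_key Inl m) i = Poly_Mapping.lookup m (Inl i)"
  by (simp add: map_key.rep_eq)

lemma single_split:
  "Poly_Mapping.single m c =
     embed_h (Poly_Mapping.single (Poly_Mapping.map_key Inl m) c) *
     d_monom (\<lambda>j. Poly_Mapping.lookup m (Inr (j :: 'n::finite) :: 'l::finite + 'n))"
  unfolding single_eq_prod_Var[of m] embed_h_def subst_single d_monom_def prod_sum_type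
    lookup_map_key_Inl
  by (simp add: mult.assoc)

lemma mpol_sum_induct [case_names add monom]:
  assumes "\<And>p q. P p \<Longrightarrow> P q \<Longrightarrow> P (p + q)" "\<And>f e. P (embed_h f * d_monom e)"
  shows "P (g :: ('l::finite + 'n::finite) mpol)"
proof (induction g rule: pm_induct)
  case zero
  show ?case using assms(2)[of 0] by (simp add: embed_h_def)
next
  case (add p m c)
  then show ?case using assms unfolding single_split[of m c] by blast
qed

lemma embed_add: "embed_h (p + q) = embed_h p + embed_h q"
  and embed_mult: "embed_h (p * q) = embed_h p * embed_h q"
  and embed_diff: "embed_h (p - q) = embed_h p - embed_h q"
  and embed_mscale: "embed_h (mscale c p) = mscale c (embed_h p)"
  and embed_sum: "embed_h (sum f A) = (\<Sum>a\<in>A. embed_h (f a))"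
  and embed_zero [simp]: "embed_h 0 = 0"
  and embed_one [simp]: "embed_h 1 = 1"
  and embed_Var [simp]: "embed_h (Var i) = Var (Inl i)"
  by (simp_all add: embed_h_def subst_add subst_mult subst_mscale subst_sum subst_diff)

lemma tau_pow_embed: "tau_pow r (embed_h f) = embed_h f"
  unfolding tau_pow_def embed_h_def subst_subst by simp

lemma d_monom_Suc:
  "d_monom e * Var (Inr j) = (d_monom (e(j := Suc (e j))) :: ('l::finite + 'n::finite) mpol)"
proof -
  have "(d_monom (e(j := Suc (e j))) :: ('l + 'n) mpol) =
      (\<Prod>i\<in>UNIV. Var (Inr i) ^ e i * (if i = j then Var (Inr i) else 1))"
    unfolding d_monom_def by (intro prod.cong) auto
  then show ?thesis by (simp add: d_monom_def prod.distrib)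
qed

locale mscale_linear =
  fixes \<rho> :: "'l::finite mpol \<Rightarrow> 'l mpol"
  assumes add: "\<rho> (f + g) = \<rho> f + \<rho> g" and scl: "\<rho> (mscale c f) = mscale c (\<rho> f)"
begin

lemma zero [simp]: "\<rho> 0 = 0" using add[of 0 0] by simp

lemma ext_add: "ext_act \<rho> (g + g') = ext_act \<rho> g + ext_act \<rho> g'"
  unfolding ext_act_def by (intro lin_ext_add) (auto simp: single_add add embed_add algebra_simps)

lemma ext_monom: "ext_act \<rho> (embed_h f * d_monom e) = embed_h (\<rho> f) * d_monom e"
proof (rule additive_pm_eqI[where p = f])
  fix m :: "'l \<Rightarrow>\<^sub>0 nat" and c
  define k where "k = Abs_poly_mapping (\<lambda>v. case v of Inl i \<Rightarrow> Poly_Mapping.lookup m i | Inr j \<Rightarrow> e j)"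
  have k: "Poly_Mapping.lookup k (Inl i) = Poly_Mapping.lookup m i"
    "Poly_Mapping.lookup k (Inr j) = e j" for i j
    unfolding k_def by (simp_all add: lookup_Abs_poly_mapping[OF finite])
  have kL: "Poly_Mapping.map_key Inl k = m"
    by (rule poly_mapping_eqI) (simp add: lookup_map_key_Inl k)
  have "embed_h (Poly_Mapping.single m c) * d_monom e = Poly_Mapping.single k c"
    using single_split[of k c] by (simp add: k kL)
  then show "ext_act \<rho> (embed_h (Poly_Mapping.single m c) * d_monom e) =
      embed_h (\<rho> (Poly_Mapping.single m c)) * d_monom e"
    by (simp add: ext_act_def lin_ext_single k kL)
qed (simp_all add: embed_add ext_add add algebra_simps)

lemma ext_mscale: "ext_act \<rho> (mscale c g) = mscale c (ext_act \<rho> g)"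
proof (induction g rule: mpol_sum_induct)
  case (monom f e)
  have "mscale c (embed_h p * d_monom e) = embed_h (mscale c p) * d_monom e"
    for p :: "'l mpol"
    by (simp add: embed_mscale) (simp add: mscale_def mult.assoc)
  then show ?case by (simp add: ext_monom scl)
qed (simp add: mscale_def ext_add distrib_left)

lemma ext_mult_d: "ext_act \<rho> (g * Var (Inr j)) = ext_act \<rho> g * Var (Inr j)"
proof (induction g rule: mpol_sum_induct)
  case (monom f e)
  show ?case
    using ext_monom[of f "e(j := Suc (e j))"] ext_monom[of f e]
    by (simp add: mult.assoc d_monom_Suc)
qed (simp add: ext_add algebra_simps)

lemma ext_mult_Cst: "ext_act \<rho> (g * Cst c) = ext_act \<rho> g * Cst c"
  using ext_mscale[of c g] by (simp add: mscale_def mult.commute)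

definition central :: "('l + 'n::finite) mpol \<Rightarrow> bool" where
  "central q \<longleftrightarrow> (\<forall>g. ext_act \<rho> (g * q) = ext_act \<rho> g * q)"

lemma central_Cst: "central (Cst c)" and central_Var: "central (Var (Inr j))"
  by (simp_all add: central_def ext_mult_d ext_mult_Cst)

lemma central_one: "central 1"
  using central_Cst[of 1] by simp

lemma central_zero: "central 0"
  using central_Cst[of 0] by simp

lemma central_add: "central p \<Longrightarrow> central q \<Longrightarrow> central (p + q)"
  by (simp add: central_def ext_add distrib_left)

lemma central_mult: "central p \<Longrightarrow> central q \<Longrightarrow> central (p * q)"
  unfolding central_def by (metis mult.assoc)

lemma central_diff: "central p \<Longrightarrow> central q \<Longrightarrow> central (p - q)"
  using central_add[of p "Cst (- 1) * q"] central_mult[OF central_Cst, of q "- 1"]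
  by (simp add: Cst_minus)

lemma central_mscale: "central p \<Longrightarrow> central (mscale c p)"
  unfolding mscale_def by (rule central_mult[OF central_Cst])

lemma central_sum: "(\<And>a. a \<in> A \<Longrightarrow> central (f a)) \<Longrightarrow> central (sum f A)"
  by (induction A rule: infinite_finite_induct) (auto simp: central_zero central_add)

lemma central_power: "central p \<Longrightarrow> central (p ^ k)"
  by (induction k) (auto simp: central_one central_mult)

lemma central_prod: "(\<And>a. a \<in> A \<Longrightarrow> central (f a)) \<Longrightarrow> central (prod f A)"
  by (induction A rule: infinite_finite_induct) (auto simp: central_one central_mult)

lemma tau_pow_d_monom:
  "tau_pow r (d_monom e) = (\<Prod>j\<in>UNIV. (Var (Inr j) - Cst (of_int (r $ j))) ^ e j)"
  by (simp add: tau_pow_def d_monom_def subst_prod subst_power Cst_of_int)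

lemma ext_embed: "ext_act \<rho> (embed_h f) = embed_h (\<rho> f)"
  using ext_monom[of f "\<lambda>_. 0"] by (simp add: d_monom_def)

lemma ext_tau_pow: "ext_act \<rho> (tau_pow r g) = tau_pow r (ext_act \<rho> g)"
proof (induction g rule: mpol_sum_induct)
  case (add p q)
  then show ?case by (simp add: tau_pow_def subst_add ext_add)
next
  case (monom f e)
  have m: "tau_pow r (embed_h f * d_monom e) = embed_h f * tau_pow r (d_monom e)"
    for f :: "'l mpol"
    using tau_pow_embed[of r f] by (simp add: tau_pow_def subst_mult)
  have "central (tau_pow r (d_monom e))"
    unfolding tau_pow_d_monom
    by (intro central_prod central_power central_diff central_Var central_Cst)
  then have "ext_act \<rho> (embed_h f * tau_pow r (d_monom e)) = embed_h (\<rho> f) * tau_pow r (d_monom e)"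
    by (simp add: central_def ext_embed)
  then show ?case by (simp add: m ext_monom)
qed

end

subsection \<open>The action\<close>

definition d_pol :: "complex \<Rightarrow> int ^ 'n \<Rightarrow> complex ^ 'n \<Rightarrow> ('l::finite + 'n::finite) mpol" where
  "d_pol a r u = (\<Sum>j\<in>UNIV. mscale (u $ j) (Var (Inr j))) - Cst (dotc u (cvec r) * (a + 1))"

definition loop_part ::
  "complex ^ 'n::finite \<Rightarrow> ('g \<Rightarrow> 'l::finite mpol \<Rightarrow> 'l mpol) \<Rightarrow> ((int ^ 'n) \<Rightarrow>\<^sub>0 'g::ab_group_add) \<Rightarrow>
   ('l + 'n) mpol \<Rightarrow> ('l + 'n) mpol" where
  "loop_part \<Lambda> \<rho> f g = lin_ext (\<lambda>r x. mscale (lam_pow \<Lambda> r) (ext_act (\<rho> x) (tau_pow r g))) f"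

definition der_part ::
  "complex ^ 'n::finite \<Rightarrow> complex \<Rightarrow> 'n der \<Rightarrow> ('l::finite + 'n) mpol \<Rightarrow> ('l + 'n) mpol" where
  "der_part \<Lambda> a D g = lin_ext (\<lambda>r u. mscale (lam_pow \<Lambda> r) (tau_pow r g * d_pol a r u)) D"

definition hat_act ::
  "complex ^ 'n::finite \<Rightarrow> complex \<Rightarrow> ('g \<Rightarrow> 'l::finite mpol \<Rightarrow> 'l mpol) \<Rightarrow>
   ('g::ab_group_add, 'n) toroidal \<Rightarrow> ('l + 'n) mpol \<Rightarrow> ('l + 'n) mpol" where
  "hat_act \<Lambda> a \<rho> = (\<lambda>(f, k, D) g. loop_part \<Lambda> \<rho> f g + der_part \<Lambda> a D g)"

lemma mscale_add: "mscale c (p + q) = mscale c p + mscale c q"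
  and mscale_diff: "mscale c (p - q) = mscale c p - mscale c q"
  and mscale_add_left: "mscale (c + d) p = mscale c p + mscale d p"
  and mscale_mscale: "mscale c (mscale d p) = mscale (c * d) p"
  and mscale_zero [simp]: "mscale c 0 = 0"
  and mscale_zero_left [simp]: "mscale 0 p = 0"
  and mscale_one [simp]: "mscale 1 p = p"
  and mscale_mult: "mscale c p * q = mscale c (p * q)" "p * mscale c q = mscale c (p * q)"
  by (simp_all add: mscale_def Cst_add Cst_mult algebra_simps)

lemma lam_pow_add:
  assumes "\<And>j. \<Lambda> $ j \<noteq> 0" shows "lam_pow \<Lambda> (r + s) = lam_pow \<Lambda> r * lam_pow \<Lambda> s"
  using assms by (simp add: lam_pow_def power_int_add prod.distrib)

lemma tau_pow_plus: "tau_pow r (p + q) = tau_pow r p + tau_pow r q"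
  and tau_pow_mult: "tau_pow r (p * q) = tau_pow r p * tau_pow r q"
  and tau_pow_mscale: "tau_pow r (mscale c p) = mscale c (tau_pow r p)"
  and tau_pow_0 [simp]: "tau_pow r 0 = 0"
  by (simp_all add: tau_pow_def subst_add subst_mult subst_mscale)

lemma d_pol_add: "d_pol a r (u + v) = d_pol a r u + d_pol a r v"
  by (simp add: d_pol_def mscale_add_left sum.distrib dotc_add_left distrib_right Cst_add)

lemma d_pol_0 [simp]: "d_pol a r 0 = 0"
  by (simp add: d_pol_def)

lemma mscale_sum: "mscale c (sum f A) = (\<Sum>x\<in>A. mscale c (f x))"
  by (simp add: mscale_def sum_distrib_left)

lemma mscale_Cst: "mscale c (Cst d) = Cst (c * d)"
  by (simp add: mscale_def Cst_mult)

lemma Cst_sum: "Cst (sum f A) = (\<Sum>x\<in>A. Cst (f x))"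
  by (induction A rule: infinite_finite_induct) (auto simp: Cst_add)

lemma d_pol_scale: "d_pol a r (c *s u) = mscale c (d_pol a r u)"
  by (simp add: d_pol_def mscale_diff mscale_mscale dotc_scale_left mult.assoc mscale_sum mscale_Cst)

lemma d_pol_diff: "d_pol a r (u - v) = d_pol a r u - d_pol a r v"
  by (simp add: eq_diff_eq flip: d_pol_add)

lemma d_pol_shift: "d_pol a (r + s) u = d_pol a r u - Cst (dotc u (cvec s) * (a + 1))"
  by (simp add: d_pol_def cvec_add dotc_add_right distrib_right Cst_add)

lemma tau_pow_Var: "tau_pow s (mscale c (Var (Inr j))) = mscale c (Var (Inr j)) - Cst (c * of_int (s $ j))"
  unfolding tau_pow_def subst_mscale subst_Var
  by (simp add: mscale_diff mscale_Cst flip: Cst_of_int)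

lemma tau_pow_sum: "tau_pow r (sum f A) = (\<Sum>x\<in>A. tau_pow r (f x))"
  and tau_pow_diff: "tau_pow r (p - q) = tau_pow r p - tau_pow r q"
  and tau_pow_Cst: "tau_pow r (Cst c) = Cst c"
  by (simp_all add: tau_pow_def subst_sum subst_diff)

lemma tau_pow_d_pol: "tau_pow s (d_pol a r u) = d_pol a r u - Cst (dotc u (cvec s))"
  unfolding d_pol_def tau_pow_diff tau_pow_sum tau_pow_Var tau_pow_Cst
  by (simp add: sum_subtractf dotc_def cvec_def Cst_sum)

lemma lie_moduleD:
  assumes "lie_module sG b sV act"
  shows "act z (v + w) = act z v + act z w" "act z (sV c v) = sV c (act z v)"
    "act (z + z') v = act z v + act z' v" "act (sG c z) v = sV c (act z v)"
    "act (b z z') v = act z (act z' v) - act z' (act z v)"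
  using assms unfolding lie_module_def
  by (blast intro: linear_addD linear_scaleD linear_addD[where f = "\<lambda>x. act x v" for v]
        linear_scaleD[where f = "\<lambda>x. act x v" for v])+

locale M_hat_data = chevalley_lie_algebra scale br \<hh> x y h H
  for scale :: "complex \<Rightarrow> 'g::ab_group_add \<Rightarrow> 'g" and br \<hh> and x y h H :: "'l::finite \<Rightarrow> 'g" +
  fixes \<rho> :: "'g \<Rightarrow> 'l mpol \<Rightarrow> 'l mpol" and \<Lambda> :: "complex ^ 'n::finite"
  assumes M: "M_cat scale br H \<rho>" and \<Lambda>: "\<And>j. \<Lambda> $ j \<noteq> 0"
begin

lemma \<rho>_module: "lie_module scale br mscale \<rho>"
  using M by (simp add: M_cat_def)

lemmas \<rho> = lie_moduleD[OF \<rho>_module]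

sublocale rho: mscale_linear "\<rho> z" for z
  by unfold_locales (rule \<rho>)+

lemma \<rho>_zero [simp]: "\<rho> 0 f = 0"
  using \<rho>(3)[of 0 0 f] by simp

lemma ext_add_left: "ext_act (\<rho> (z + w)) g = ext_act (\<rho> z) g + ext_act (\<rho> w) g"
  by (induction g rule: mpol_sum_induct)
    (simp add: rho.ext_add algebra_simps, simp add: rho.ext_monom, simp add: \<rho>(3) embed_add distrib_right)

lemma ext_zero_left [simp]: "ext_act (\<rho> 0) g = 0"
  using ext_add_left[of 0 0 g] by simp

lemma ext_zero_right [simp]: "ext_act (\<rho> z) 0 = 0"
  using rho.ext_add[of z 0 0] by simp

lemma ext_scale_left: "ext_act (\<rho> (scale c z)) g = mscale c (ext_act (\<rho> z) g)"
  by (induction g rule: mpol_sum_induct)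
    (simp add: rho.ext_add mscale_add, simp add: rho.ext_monom, simp add: \<rho>(4) embed_mscale mscale_add mscale_mult)

lemma ext_br: "ext_act (\<rho> (br z w)) g =
    ext_act (\<rho> z) (ext_act (\<rho> w) g) - ext_act (\<rho> w) (ext_act (\<rho> z) g)"
  by (induction g rule: mpol_sum_induct)
    (simp add: rho.ext_add algebra_simps, simp add: rho.ext_monom, simp add: \<rho>(5) embed_diff left_diff_distrib)

lemma loop_add_left: "loop_part \<Lambda> \<rho> (f + f') g = loop_part \<Lambda> \<rho> f g + loop_part \<Lambda> \<rho> f' g"
  unfolding loop_part_def by (intro lin_ext_add) (auto simp: ext_add_left mscale_add)

lemma loop_add_right: "loop_part \<Lambda> \<rho> f (g + g') = loop_part \<Lambda> \<rho> f g + loop_part \<Lambda> \<rho> f g'"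
  unfolding loop_part_def
  by (intro lin_ext_add_fun) (auto simp: tau_pow_plus rho.ext_add mscale_add)

lemma loop_zero_left [simp]: "loop_part \<Lambda> \<rho> 0 g = 0"
  by (simp add: loop_part_def)

lemma loop_diff_left: "loop_part \<Lambda> \<rho> (f - f') g = loop_part \<Lambda> \<rho> f g - loop_part \<Lambda> \<rho> f' g"
  using loop_add_left[of "f - f'" f' g] by simp

lemma loop_single: "loop_part \<Lambda> \<rho> (Poly_Mapping.single r z) g =
    mscale (lam_pow \<Lambda> r) (ext_act (\<rho> z) (tau_pow r g))"
  unfolding loop_part_def by (subst lin_ext_single) auto

lemma loop_scale_left: "loop_part \<Lambda> \<rho> (pm_scale scale c f) g = mscale c (loop_part \<Lambda> \<rho> f g)"
  unfolding loop_part_def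
  by (rule lin_ext_scale[OF vector_space_axioms])
    (auto simp: ext_scale_left mscale_mscale mscale_add mult.commute)

lemma loop_scale_right: "loop_part \<Lambda> \<rho> f (mscale c g) = mscale c (loop_part \<Lambda> \<rho> f g)"
  by (rule additive_pm_eqI[where p = f])
    (auto simp: loop_add_left mscale_add loop_single tau_pow_mscale rho.ext_mscale mscale_mscale
      mult.commute)

lemma der_add_left: "der_part \<Lambda> a (D + E) g = der_part \<Lambda> a D g + der_part \<Lambda> a E g"
  unfolding der_part_def by (intro lin_ext_add) (auto simp: d_pol_add distrib_left mscale_add)

lemma der_add_right: "der_part \<Lambda> a D (g + g') = der_part \<Lambda> a D g + der_part \<Lambda> a D g'"
  unfolding der_part_def
  by (intro lin_ext_add_fun) (auto simp: tau_pow_plus distrib_right mscale_add)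

lemma der_zero_left [simp]: "der_part \<Lambda> a 0 g = 0"
  by (simp add: der_part_def)

lemma der_single: "der_part \<Lambda> a (Poly_Mapping.single r u) g =
    mscale (lam_pow \<Lambda> r) (tau_pow r g * d_pol a r u)"
  unfolding der_part_def by (subst lin_ext_single) auto

lemma der_scale_left: "der_part \<Lambda> a (pm_scale (*s) c D) g = mscale c (der_part \<Lambda> a D g)"
  unfolding der_part_def
  by (rule lin_ext_scale[OF vector_space_vec_scale])
    (auto simp: d_pol_scale mscale_mult mscale_mscale mscale_add mult.commute)

lemma der_scale_right: "der_part \<Lambda> a D (mscale c g) = mscale c (der_part \<Lambda> a D g)"
  by (rule additive_pm_eqI[where p = D])
    (auto simp: der_add_left mscale_add der_single tau_pow_mscale mscale_mscale mscale_mult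
      mult.commute)

lemma biadditive_loop: "biadditive (\<lambda>r z s w. Poly_Mapping.single (r + s) (br z w))"
  by unfold_locales
    (simp_all add: linear_addD[OF br_linear_left] linear_addD[OF br_linear_right] single_add)

lemma biadditive_der_act:
  "biadditive (\<lambda>r u q z. Poly_Mapping.single (r + q) (scale (dotc u (cvec q)) z))"
  by unfold_locales
    (simp_all add: scale_left_distrib scale_right_distrib dotc_add_left single_add)

lemma loop_loop:
  "loop_part \<Lambda> \<rho> (loop_br br f f') g =
    loop_part \<Lambda> \<rho> f (loop_part \<Lambda> \<rho> f' g) - loop_part \<Lambda> \<rho> f' (loop_part \<Lambda> \<rho> f g)"
proof (rule additive_pm_eqI[where p = f])
  fix r z
  show "loop_part \<Lambda> \<rho> (loop_br br (Poly_Mapping.single r z) f') g =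
      loop_part \<Lambda> \<rho> (Poly_Mapping.single r z) (loop_part \<Lambda> \<rho> f' g) -
      loop_part \<Lambda> \<rho> f' (loop_part \<Lambda> \<rho> (Poly_Mapping.single r z) g)"
  proof (rule additive_pm_eqI[where p = f'])
    fix s w
    have "tau_pow r (tau_pow s g) = tau_pow s (tau_pow r g)"
      by (simp add: add.commute flip: tau_pow_add)
    then show "loop_part \<Lambda> \<rho> (loop_br br (Poly_Mapping.single r z) (Poly_Mapping.single s w)) g =
        loop_part \<Lambda> \<rho> (Poly_Mapping.single r z) (loop_part \<Lambda> \<rho> (Poly_Mapping.single s w) g) -
        loop_part \<Lambda> \<rho> (Poly_Mapping.single s w) (loop_part \<Lambda> \<rho> (Poly_Mapping.single r z) g)"
      unfolding loop_br_def biadditive.ext_single[OF biadditive_loop]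
      by (simp add: loop_single ext_br tau_pow_mscale rho.ext_mscale mscale_mscale tau_pow_add
          lam_pow_add[OF \<Lambda>] mscale_diff mult.commute rho.ext_tau_pow[symmetric])
  qed (simp_all add: loop_br_def biadditive.ext_right[OF biadditive_loop] loop_add_left
      loop_add_right)
qed (simp_all add: loop_br_def biadditive.ext_left[OF biadditive_loop] loop_add_left
    loop_add_right)

lemma central_d_pol: "rho.central z (d_pol a r u)"
  unfolding d_pol_def
  by (intro rho.central_diff rho.central_sum rho.central_mscale rho.central_Var rho.central_Cst)

lemma der_loop:
  "loop_part \<Lambda> \<rho> (der_act scale D f) g =
    der_part \<Lambda> a D (loop_part \<Lambda> \<rho> f g) - loop_part \<Lambda> \<rho> f (der_part \<Lambda> a D g)"
proof (rule additive_pm_eqI[where p = D])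
  fix r u
  show "loop_part \<Lambda> \<rho> (der_act scale (Poly_Mapping.single r u) f) g =
      der_part \<Lambda> a (Poly_Mapping.single r u) (loop_part \<Lambda> \<rho> f g) -
      loop_part \<Lambda> \<rho> f (der_part \<Lambda> a (Poly_Mapping.single r u) g)"
  proof (rule additive_pm_eqI[where p = f])
    fix s z
    have comm: "tau_pow s (tau_pow r g) = tau_pow (r + s) g"
      by (simp add: add.commute flip: tau_pow_add)
    have ext: "ext_act (\<rho> z) (tau_pow (r + s) g * (d_pol a r u - Cst c)) =
        ext_act (\<rho> z) (tau_pow (r + s) g) * (d_pol a r u - Cst c)" for c
      by (rule rho.central_diff[OF central_d_pol rho.central_Cst, unfolded rho.central_def,
            rule_format])
    have "der_part \<Lambda> a (Poly_Mapping.single r u) (loop_part \<Lambda> \<rho> (Poly_Mapping.single s z) g) -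
        loop_part \<Lambda> \<rho> (Poly_Mapping.single s z) (der_part \<Lambda> a (Poly_Mapping.single r u) g) =
        mscale (lam_pow \<Lambda> (r + s)) (ext_act (\<rho> z) (tau_pow (r + s) g) * d_pol a r u) -
        mscale (lam_pow \<Lambda> (r + s))
          (ext_act (\<rho> z) (tau_pow (r + s) g) * (d_pol a r u - Cst (dotc u (cvec s))))"
      by (simp add: loop_single der_single tau_pow_mscale rho.ext_tau_pow[symmetric] tau_pow_mult
          tau_pow_d_pol comm ext rho.ext_mscale mscale_mscale mscale_mult lam_pow_add[OF \<Lambda>]
          mult.commute[of "lam_pow \<Lambda> s"] add.commute[of s r] flip: tau_pow_add)
    also have "\<dots> = mscale (lam_pow \<Lambda> (r + s))
        (mscale (dotc u (cvec s)) (ext_act (\<rho> z) (tau_pow (r + s) g)))"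
      by (simp add: mscale_def algebra_simps)
    also have "\<dots> = loop_part \<Lambda> \<rho> (der_act scale (Poly_Mapping.single r u) (Poly_Mapping.single s z)) g"
      unfolding der_act_def biadditive.ext_single[OF biadditive_der_act]
      by (simp add: loop_single ext_scale_left)
    finally show "loop_part \<Lambda> \<rho> (der_act scale (Poly_Mapping.single r u) (Poly_Mapping.single s z)) g =
        der_part \<Lambda> a (Poly_Mapping.single r u) (loop_part \<Lambda> \<rho> (Poly_Mapping.single s z) g) -
        loop_part \<Lambda> \<rho> (Poly_Mapping.single s z) (der_part \<Lambda> a (Poly_Mapping.single r u) g)"
      by simp
  qed (simp_all add: der_act_def biadditive.ext_right[OF biadditive_der_act] loop_add_left
      loop_add_right der_add_left der_add_right)
qed (simp_all add: der_act_def biadditive.ext_left[OF biadditive_der_act] loop_add_left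
    loop_add_right der_add_left der_add_right)

lemma der_der:
  "der_part \<Lambda> a (der_br D E) (g :: ('l + 'n) mpol) =
    der_part \<Lambda> a D (der_part \<Lambda> a E g) - der_part \<Lambda> a E (der_part \<Lambda> a D g)"
proof (rule additive_pm_eqI[where p = D])
  fix r :: "int ^ 'n" and u :: "complex ^ 'n"
  show "der_part \<Lambda> a (der_br (Poly_Mapping.single r u) E) g =
      der_part \<Lambda> a (Poly_Mapping.single r u) (der_part \<Lambda> a E g) -
      der_part \<Lambda> a E (der_part \<Lambda> a (Poly_Mapping.single r u) g)"
  proof (rule additive_pm_eqI[where p = E])
    fix s :: "int ^ 'n" and v :: "complex ^ 'n"
    define p :: "('l + 'n) mpol" where "p = d_pol a 0 u"
    define q :: "('l + 'n) mpol" where "q = d_pol a 0 v"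
    have d: "d_pol a k u = p - Cst (dotc u (cvec k) * (a + 1))"
      "d_pol a k v = q - Cst (dotc v (cvec k) * (a + 1))" for k
      by (simp_all add: p_def q_def flip: d_pol_shift)
    have comm: "tau_pow s (tau_pow r g) = tau_pow (r + s) g"
      by (simp add: add.commute flip: tau_pow_add)
    have "(d_pol a (r + s) (dotc u (cvec s) *s v - dotc v (cvec r) *s u) :: ('l + 'n) mpol) =
        (d_pol a s v - Cst (dotc v (cvec r))) * d_pol a r u -
        (d_pol a r u - Cst (dotc u (cvec s))) * d_pol a s v"
      by (simp add: d d_pol_diff d_pol_scale mscale_def cvec_add dotc_add_right Cst_add Cst_mult
          algebra_simps)
    then have "tau_pow (r + s) g * d_pol a (r + s) (dotc u (cvec s) *s v - dotc v (cvec r) *s u) =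
        tau_pow (r + s) g * (d_pol a s v - Cst (dotc v (cvec r))) * d_pol a r u -
        tau_pow (r + s) g * (d_pol a r u - Cst (dotc u (cvec s))) * d_pol a s v"
      by (simp only: right_diff_distrib[of _ "_ * _" "_ * _"] mult.assoc)
    then show "der_part \<Lambda> a (der_br (Poly_Mapping.single r u) (Poly_Mapping.single s v)) g =
        der_part \<Lambda> a (Poly_Mapping.single r u) (der_part \<Lambda> a (Poly_Mapping.single s v) g) -
        der_part \<Lambda> a (Poly_Mapping.single s v) (der_part \<Lambda> a (Poly_Mapping.single r u) g)"
      unfolding der_br_def biadditive.ext_single[OF biadditive_der_br]
      by (simp add: der_single tau_pow_mscale tau_pow_mult tau_pow_d_pol comm mscale_mscale
          mscale_mult lam_pow_add[OF \<Lambda>] mscale_diff mult.commute[of "lam_pow \<Lambda> s"] add.commute[of s r]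
          flip: tau_pow_add)
  qed (simp_all add: der_br_def biadditive.ext_right[OF biadditive_der_br]
      der_add_left der_add_right)
qed (simp_all add: der_br_def biadditive.ext_left[OF biadditive_der_br]
    der_add_left der_add_right)

lemma hat_act_module:
  "lie_module (tor_scale scale) (tor_br scale br c1 c2) mscale (hat_act \<Lambda> a \<rho>)"
  unfolding lie_module_def
proof (intro conjI allI)
  fix X :: "('g, 'n) toroidal"
  show "Vector_Spaces.linear mscale mscale (hat_act \<Lambda> a \<rho> X)"
    by (rule linear_mscaleI[OF vector_space_mscale])
      (auto simp: hat_act_def loop_add_right der_add_right loop_scale_right der_scale_right
        mscale_add split: prod.splits)
next
  fix g :: "('l + 'n) mpol"
  show "Vector_Spaces.linear (tor_scale scale) mscale (\<lambda>X. hat_act \<Lambda> a \<rho> X g)"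
    by (rule linear_mscaleI[OF vector_space_tor[OF vector_space_axioms]])
      (auto simp: hat_act_def tor_scale_def loop_add_left der_add_left loop_scale_left
        der_scale_left mscale_add split: prod.splits)
next
  fix X Y :: "('g, 'n) toroidal" and g :: "('l + 'n) mpol"
  obtain f k D f' k' D' where XY: "X = (f, k, D)" "Y = (f', k', D')"
    by (metis prod.exhaust)
  show "hat_act \<Lambda> a \<rho> (tor_br scale br c1 c2 X Y) g =
      hat_act \<Lambda> a \<rho> X (hat_act \<Lambda> a \<rho> Y g) - hat_act \<Lambda> a \<rho> Y (hat_act \<Lambda> a \<rho> X g)"
    by (simp add: XY hat_act_def tor_br_def loop_add_left loop_diff_left loop_loop der_loop[of _ _ _ a]
        der_der loop_add_right der_add_right)
qed

end

lemma d_pol_axis: "d_pol a r (axis j 1) = Var (Inr j) - Cst (of_int (r $ j) * (a + 1))"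
proof -
  have "(\<Sum>i\<in>UNIV. mscale (axis j 1 $ i) (f i)) = f j" for f :: "'b \<Rightarrow> ('a + 'b) mpol"
    by (simp add: axis_def if_distrib[of "\<lambda>c. mscale c _"] cong: if_cong)
  then show ?thesis by (simp add: d_pol_def dotc_axis cvec_def)
qed

context M_hat_data
begin

lemma \<rho>_H_sum: "\<rho> (\<Sum>i\<in>UNIV. scale (c i) (H i)) f = (\<Sum>i\<in>UNIV. mscale (c i) (Var i)) * f"
  using M by (simp add: M_cat_def)

lemma \<rho>_H: "\<rho> (H j) f = Var j * f"
proof -
  have "(\<Sum>i\<in>UNIV. scale (if i = j then 1 else 0) (H i)) = H j"
    by (simp add: if_distrib[of "\<lambda>c. scale c _"] cong: if_cong)
  moreover have "(\<Sum>i\<in>UNIV. mscale (if i = j then 1 else 0) (Var i)) = (Var j :: 'l mpol)"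
    by (simp add: if_distrib[of "\<lambda>c. mscale c _"] cong: if_cong)
  ultimately show ?thesis using \<rho>_H_sum[of "\<lambda>i. if i = j then 1 else 0" f] by simp
qed

lemma \<rho>_neg: "\<rho> (- z) f = - \<rho> z f"
  using \<rho>(3)[of "- z" z f] by (simp add: eq_neg_iff_add_eq_0)

lemma \<rho>_Cst: "\<rho> z (Cst c) = Cst c * \<rho> z 1"
  using \<rho>(2)[of z c 1] by (simp add: mscale_def)

lemma \<rho>_x_Var: "\<rho> (x i) (Var j * f) = (Var j - (if i = j then 1 else 0)) * \<rho> (x i) f"
  using \<rho>(5)[of "H j" "x i" f] H_x[of j i] by (auto simp: \<rho>_H algebra_simps split: if_splits)

lemma \<rho>_y_Var: "\<rho> (y i) (Var j * f) = (Var j + (if i = j then 1 else 0)) * \<rho> (y i) f"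
  using \<rho>(5)[of "H j" "y i" f] H_y[of j i]
  by (auto simp: \<rho>_H \<rho>_neg algebra_simps split: if_splits)

lemma ext_subst:
  assumes c: "\<And>f j. \<rho> z (Var j * f) = \<theta> j * \<rho> z f"
    and \<theta>: "\<And>j. \<theta>' (Inl j) = embed_h (\<theta> j)" "\<And>j. \<theta>' (Inr j) = Var (Inr j)"
  shows "ext_act (\<rho> z) g = subst \<theta>' g * embed_h (\<rho> z 1)"
proof (induction g rule: mpol_sum_induct)
  case (add p q)
  then show ?case by (simp add: rho.ext_add subst_add distrib_right)
next
  case (monom f e)
  have f: "embed_h (\<rho> z f) = subst \<theta>' (embed_h f) * embed_h (\<rho> z 1)"
  proof (induction f rule: mpol_induct)
    case (Cst c)
    show ?case by (subst \<rho>_Cst) (simp add: embed_mult, simp add: embed_h_def)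
  next
    case (add p q)
    then show ?case by (simp add: rho.add embed_add subst_add distrib_right)
  next
    case (Var v p)
    then show ?case by (simp add: c embed_mult subst_mult \<theta> mult.assoc)
  qed
  have e: "subst \<theta>' (d_monom e) = d_monom e"
    by (simp add: d_monom_def subst_prod subst_power \<theta>)
  show ?case
    unfolding rho.ext_monom subst_mult f e by (simp only: mult_ac)
qed

lemma ext_x: "ext_act (\<rho> (x i)) g = sigma i g * embed_h (\<rho> (x i) 1)"
  unfolding sigma_def by (rule ext_subst[OF \<rho>_x_Var]) (auto simp: embed_diff)

lemma ext_y: "ext_act (\<rho> (y i)) g = inv (sigma i) g * embed_h (\<rho> (y i) 1)"
  unfolding inv_sigma by (rule ext_subst[OF \<rho>_y_Var]) (auto simp: embed_add)

lemma ext_H: "ext_act (\<rho> (\<Sum>i\<in>UNIV. scale (c i) (H i))) g =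
    (\<Sum>i\<in>UNIV. mscale (c i) (Var (Inl i))) * g"
proof (induction g rule: mpol_sum_induct)
  case (add p q)
  then show ?case by (simp add: rho.ext_add distrib_left)
next
  case (monom f e)
  show ?case
    by (simp add: rho.ext_monom, simp add: \<rho>_H_sum embed_mult embed_sum embed_mscale mult.assoc)
qed

lemma hat_act_is_M_hat: "is_M_hat scale br c1 c2 x y H \<Lambda> a \<rho> (hat_act \<Lambda> a \<rho>)"
  unfolding is_M_hat_def
proof (intro conjI allI)
  fix g :: "('l + 'n) mpol" and r :: "int ^ 'n" and j :: 'n
  show "hat_act \<Lambda> a \<rho> (K_elt r j) g = 0"
    by (simp add: hat_act_def K_elt_def)
  show "hat_act \<Lambda> a \<rho> (D_elt r j) g =
      mscale (lam_pow \<Lambda> r) (tau_pow r g * (Var (Inr j) - Cst (of_int (r $ j) * (a + 1))))"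
    by (simp add: hat_act_def D_elt_def tD_def der_single d_pol_axis)
qed (simp_all add: hat_act_module, simp_all add: hat_act_def loop_elt_def loop_single ext_x ext_y ext_H)

lemma chevalley_generate:
  assumes "subalgebra T \<and> range x \<union> range y \<union> range h \<subseteq> T" shows "T = UNIV"
proof -
  have "\<forall>T. subalgebra T \<and> range x \<union> range y \<union> range h \<subseteq> T \<longrightarrow> T = UNIV"
    using chevalley unfolding chevalley_generators_def by (rule conjunct2)
  from spec[OF this, of T] assms show ?thesis by (rule mp)
qed

lemma is_M_hat_unique:
  fixes act act' :: "('g, 'n) toroidal \<Rightarrow> ('l + 'n) mpol \<Rightarrow> ('l + 'n) mpol"
  assumes "is_M_hat scale br c1 c2 x y H \<Lambda> a \<rho> act" "is_M_hat scale br c1 c2 x y H \<Lambda> a \<rho> act'"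
  shows "act = act'"
proof -
  have mod: "lie_module (tor_scale scale) (tor_br scale br c1 c2) mscale act"
    "lie_module (tor_scale scale) (tor_br scale br c1 c2) mscale act'"
    using assms by (simp_all add: is_M_hat_def)
  note A = lie_moduleD[OF mod(1)] and A' = lie_moduleD[OF mod(2)]
  have zero: "act 0 g = 0" "act' 0 g = 0" for g
    using A(3)[of 0 0 g] A'(3)[of 0 0 g] by simp_all
  have K: "act'' (0, k, 0) g = 0"
    if hat: "is_M_hat scale br c1 c2 x y H \<Lambda> a \<rho> act''" for act'' k g
  proof (induction k rule: KA_induct)
    case zero
    have "lie_module (tor_scale scale) (tor_br scale br c1 c2) mscale act''"
      using hat by (simp add: is_M_hat_def)
    from lie_moduleD(3)[OF this, of 0 0 g] show ?case by (simp flip: zero_prod_def)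
  next
    case (add k c r j)
    have mod'': "lie_module (tor_scale scale) (tor_br scale br c1 c2) mscale act''"
      using hat by (simp add: is_M_hat_def)
    have "act'' (K_elt r j) g = 0" using hat by (simp add: is_M_hat_def)
    then have "act'' (0, KA_scale c (tK r j), 0) g = 0"
      using lie_moduleD(4)[OF mod'', of c "K_elt r j" g]
      by (simp add: tor_scale_def K_elt_def pm_scale_def Poly_Mapping.map_def)
    then show ?case
      using add lie_moduleD(3)[OF mod'', of "(0, k, 0)" "(0, KA_scale c (tK r j), 0)" g] by simp
  qed
  define T where "T = {z. \<forall>r g. act (loop_elt z r) g = act' (loop_elt z r) g}"
  have loop_add: "loop_elt (z + w) r = loop_elt z r + loop_elt w r" for z w :: 'g and r :: "int ^ 'n"
    by (simp add: loop_elt_def single_add)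
  have loop_scale: "loop_elt (scale c z) r = tor_scale scale c (loop_elt z r)"
    for c and z :: 'g and r :: "int ^ 'n"
    by (simp add: loop_elt_def tor_scale_def pm_scale_single[OF vector_space_axioms])
  have br_eq: "\<exists>k. tor_br scale br c1 c2 (loop_elt z r) (loop_elt w 0) = loop_elt (br z w) r + (0, k, 0)"
    for z w :: 'g and r :: "int ^ 'n"
    unfolding tor_br_def loop_elt_def loop_br_def biadditive.ext_single[OF biadditive_loop]
    by (simp add: loop_br_def biadditive.ext_single[OF biadditive_loop] der_act_def der_br_def)
  have sub: "subalgebra T"
    unfolding subalgebra_def subspace_def
  proof (intro conjI ballI allI)
    show "0 \<in> T" by (simp add: T_def loop_elt_def zero flip: zero_prod_def)
  next
    fix z w assume zw: "z \<in> T" "w \<in> T"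
    then show "z + w \<in> T" by (simp add: T_def loop_add A(3) A'(3))
    show "br z w \<in> T"
      unfolding T_def
    proof (intro CollectI allI)
      fix r :: "int ^ 'n" and g
      obtain k where k: "tor_br scale br c1 c2 (loop_elt z r) (loop_elt w 0) =
          loop_elt (br z w) r + (0, k, 0)"
        using br_eq by blast
      have "act (loop_elt (br z w) r) g =
          act (tor_br scale br c1 c2 (loop_elt z r) (loop_elt w 0)) g"
        by (simp add: k A(3) K[OF assms(1)])
      also have "\<dots> = act' (tor_br scale br c1 c2 (loop_elt z r) (loop_elt w 0)) g"
        using zw by (simp add: A(5) A'(5) T_def)
      also have "\<dots> = act' (loop_elt (br z w) r) g"
        by (simp add: k A'(3) K[OF assms(2)])
      finally show "act (loop_elt (br z w) r) g = act' (loop_elt (br z w) r) g" .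
    qed
  next
    fix c z assume "z \<in> T"
    then show "scale c z \<in> T" by (simp add: T_def loop_scale A(4) A'(4))
  qed
  have xy: "x i \<in> T" "y i \<in> T" for i
    using assms by (simp_all add: T_def is_M_hat_def)
  have "h i \<in> T" for i
    using chevalley sub xy[of i] by (force simp: chevalley_generators_def subalgebra_def)
  with xy sub have "subalgebra T \<and> range x \<union> range y \<union> range h \<subseteq> T" by auto
  then have T_UNIV: "T = UNIV"
    by (rule chevalley_generate)
  have loop: "act (f, 0, 0) g = act' (f, 0, 0) g" for f g
  proof (rule additive_pm_eqI[where p = f])
    show "act (p + q, 0, 0) g = act (p, 0, 0) g + act (q, 0, 0) g" for p q
      using A(3)[of "(p, 0, 0)" "(q, 0, 0)" g] by simp
    show "act' (p + q, 0, 0) g = act' (p, 0, 0) g + act' (q, 0, 0) g" for p q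
      using A'(3)[of "(p, 0, 0)" "(q, 0, 0)" g] by simp
      have "z \<in> T" for z by (simp only: T_UNIV UNIV_I)
    then show "act (Poly_Mapping.single r z, 0, 0) g = act' (Poly_Mapping.single r z, 0, 0) g" for r z
      unfolding T_def loop_elt_def by blast
  qed
  have der: "act (0, 0, D) g = act' (0, 0, D) g" for D g
  proof (rule additive_pm_eqI[where p = D])
    show "act (0, 0, p + q) g = act (0, 0, p) g + act (0, 0, q) g" for p q
      using A(3)[of "(0, 0, p)" "(0, 0, q)" g] by simp
    show "act' (0, 0, p + q) g = act' (0, 0, p) g + act' (0, 0, q) g" for p q
      using A'(3)[of "(0, 0, p)" "(0, 0, q)" g] by simp
    fix r :: "int ^ 'n" and u :: "complex ^ 'n"
    have "finite J \<Longrightarrow> act (0, 0, Poly_Mapping.single r (\<Sum>j\<in>J. u $ j *s axis j 1)) g =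
        act' (0, 0, Poly_Mapping.single r (\<Sum>j\<in>J. u $ j *s axis j 1)) g" for J
    proof (induction rule: finite_induct)
      case empty
      show ?case by (simp add: zero flip: zero_prod_def)
    next
      case (insert j J)
      have e: "(0, 0, Poly_Mapping.single r (u $ j *s axis j 1)) =
          tor_scale scale (u $ j) (D_elt r j)"
        by (simp add: tor_scale_def D_elt_def tD_def pm_scale_single[OF vector_space_vec_scale])
          (simp add: pm_scale_def Poly_Mapping.map_def)
      have "act (0, 0, Poly_Mapping.single r (u $ j *s axis j 1)) g =
          act' (0, 0, Poly_Mapping.single r (u $ j *s axis j 1)) g"
        unfolding e A(4) A'(4) using assms by (simp add: is_M_hat_def)
      with insert show ?case
        using A(3)[of "(0, 0, Poly_Mapping.single r (u $ j *s axis j 1))"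
            "(0, 0, Poly_Mapping.single r (\<Sum>j\<in>J. u $ j *s axis j 1))" g]
          A'(3)[of "(0, 0, Poly_Mapping.single r (u $ j *s axis j 1))"
            "(0, 0, Poly_Mapping.single r (\<Sum>j\<in>J. u $ j *s axis j 1))" g]
        by (simp add: single_add)
    qed
    from this[OF finite[of UNIV]]
    show "act (0, 0, Poly_Mapping.single r u) g = act' (0, 0, Poly_Mapping.single r u) g"
      by (simp only: vec_expansion)
  qed
  show ?thesis
  proof (intro ext)
    fix X :: "('g, 'n) toroidal" and g :: "('l + 'n) mpol"
    obtain f k D where "X = (f, k, D)" by (metis prod.exhaust)
    then have "X = (f, 0, 0) + ((0, k, 0) + (0, 0, D))" by simp
    then show "act X g = act' X g"
      using loop[of f g] der[of D g] K[OF assms(1), of k g] K[OF assms(2), of k g]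
      by (simp only: A(3) A'(3))
  qed
qed

end

theorem M_hat_unique_existence:
  fixes \<Lambda> :: "complex ^ 'n::finite" and x y h H :: "'l::finite \<Rightarrow> 'g::ab_group_add"
  assumes "chevalley_lie_algebra sc br \<hh> x y h H" "M_cat sc br H \<rho>" "\<And>j. \<Lambda> $ j \<noteq> 0"
  shows "\<exists>!act. is_M_hat sc br c1 c2 x y H \<Lambda> a \<rho> act"
proof -
  interpret chevalley_lie_algebra sc br \<hh> x y h H by fact
  interpret M_hat_data sc br \<hh> x y h H \<rho> \<Lambda> by unfold_locales (use assms in auto)
  show ?thesis using hat_act_is_M_hat is_M_hat_unique by blast
qed

corollary M_hat_spec:
  fixes \<Lambda> :: "complex ^ 'n::finite" and x y h H :: "'l::finite \<Rightarrow> 'g::ab_group_add"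
  assumes "chevalley_lie_algebra sc br \<hh> x y h H" "M_cat sc br H \<rho>" "\<And>j. \<Lambda> $ j \<noteq> 0"
  shows "is_M_hat sc br c1 c2 x y H \<Lambda> a \<rho> (M_hat sc br c1 c2 x y H \<Lambda> a \<rho>)"
  unfolding M_hat_def by (rule theI'[OF M_hat_unique_existence[OF assms]])

end

theory Submission
  imports Defs
begin

text \<open>
  The toroidal module is \<open>M\<^sub>\<gg> \<otimes> \<complex>[d\<^sub>1, \<dots>, d\<^sub>n]\<close>: the element \<open>z \<otimes> t\<^sup>r\<close> acts as
  \<open>\<Lambda>\<^sup>r z \<otimes> \<tau>\<^sup>r\<close>, and \<open>D(u,r)\<close> acts as \<open>\<Lambda>\<^sup>r \<tau>\<^sup>r\<close> followed by multiplication by a polynomial of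
  degree at most one in the \<open>d\<^sub>j\<close>.  Submodules of \<open>M\<^sub>\<gg>\<close> therefore extend: if \<open>W\<close> is a submodule
  then so is \<open>W \<otimes> \<complex>[d]\<close>, and \<open>W\<close> is recovered from it by setting all \<open>d\<^sub>j\<close> to zero
  (\<open>tensor_d_submodule\<close>, \<open>embed_in_tensor_d_iff\<close>).  This gives one direction.

  Conversely, let \<open>N\<close> be a nonzero submodule of the toroidal module.  It is stable under
  \<open>g \<mapsto> H\<^sub>i \<tau>\<^sub>j(g)\<close>, coming from \<open>H\<^sub>i \<otimes> t\<^sub>j\<close>, and under multiplication by \<open>H\<^sub>i\<close>, hence under
  \<open>g \<mapsto> H\<^sub>i (\<tau>\<^sub>j(g) - g)\<close>.  The latter map lowers the total degree in the \<open>d\<close>-variables, and it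
  kills \<open>g\<close> only if \<open>g\<close> does not involve \<open>d\<^sub>j\<close>, because a polynomial in one variable over \<open>\<complex>\<close>
  that is invariant under a unit shift is constant.  Iterating it produces a nonzero
  \<open>d\<close>-free element of \<open>N\<close> (\<open>descent_to_degree_zero\<close>).  The \<open>d\<close>-free elements of \<open>N\<close> form a
  \<open>\<gg>\<close>-submodule of \<open>M\<^sub>\<gg>\<close>, which is all of it when \<open>M\<^sub>\<gg>\<close> is simple, so \<open>1 \<in> N\<close>.  As \<open>N\<close> is
  stable under multiplication by all \<open>H\<^sub>i\<close> and \<open>d\<^sub>j\<close>, it is everything.
\<close>

section \<open>Polynomials and unit shifts of a variable\<close>

definition shift :: "'v::finite \<Rightarrow> 'v mpol \<Rightarrow> 'v mpol" where
  "shift v = subst (\<lambda>w. if w = v then Var w - 1 else Var w)"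

lemma lookup_Var_mult:
  "Poly_Mapping.lookup (Var v * p) m =
    (if Poly_Mapping.lookup m v = 0 then 0
     else Poly_Mapping.lookup p (m - Poly_Mapping.single v 1))"
proof (rule additive_pm_eqI[where p = p])
  fix k :: "'a \<Rightarrow>\<^sub>0 nat" and c :: complex
  have "Poly_Mapping.single v 1 + k = m \<longleftrightarrow>
      Poly_Mapping.lookup m v \<noteq> 0 \<and> k = m - Poly_Mapping.single v 1"
  proof
    assume "Poly_Mapping.lookup m v \<noteq> 0 \<and> k = m - Poly_Mapping.single v 1"
    then show "Poly_Mapping.single v 1 + k = m"
      by (intro poly_mapping_eqI) (auto simp: lookup_add lookup_minus lookup_single when_def)
  qed (auto simp: lookup_add)
  then show "Poly_Mapping.lookup (Var v * Poly_Mapping.single k c) m =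
    (if Poly_Mapping.lookup m v = 0 then 0
     else Poly_Mapping.lookup (Poly_Mapping.single k c) (m - Poly_Mapping.single v 1))"
    unfolding Var_def mult_single lookup_single when_def by auto
qed (auto simp: distrib_left lookup_add)

text \<open>Multiplication by a variable only relabels the coefficients.\<close>

lemma Var_mult_eq_0_iff: "Var v * p = 0 \<longleftrightarrow> p = 0"
proof
  assume "Var v * p = 0"
  then have "Poly_Mapping.lookup (Var v * p) (m + Poly_Mapping.single v 1) = 0" for m
    by simp
  then show "p = 0"
    by (intro poly_mapping_eqI) (simp add: lookup_Var_mult lookup_add)
qed simp

text \<open>For a monomial \<open>m\<close> free of the variable \<open>v\<close>, this is the coefficient of \<open>m\<close> when \<open>p\<close> is
  regarded as a polynomial in the other variables over \<open>\<complex>[v]\<close>.\<close>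

definition slice :: "'v \<Rightarrow> ('v \<Rightarrow>\<^sub>0 nat) \<Rightarrow> 'v mpol \<Rightarrow> complex poly" where
  "slice v m p = Abs_poly (\<lambda>k. Poly_Mapping.lookup p (m + Poly_Mapping.single v k))"

lemma coeff_slice:
  "coeff (slice v m p) k = Poly_Mapping.lookup p (m + Poly_Mapping.single v k)"
proof -
  have "inj (\<lambda>k. m + Poly_Mapping.single v k)"
    by (rule injI) (metis add_left_cancel lookup_single_eq)
  then have "finite ((\<lambda>k. m + Poly_Mapping.single v k) -` Poly_Mapping.keys p)"
    by (intro finite_vimageI) simp
  then have "\<forall>\<^sub>\<infinity>k. Poly_Mapping.lookup p (m + Poly_Mapping.single v k) = 0"
    by (simp add: MOST_iff_cofinite vimage_def in_keys_iff)
  then show ?thesis by (simp add: slice_def Abs_poly_inverse)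
qed

lemma slice_add: "slice v m (p + q) = slice v m p + slice v m q"
  by (rule poly_eqI) (simp add: coeff_slice lookup_add)

lemma slice_diff: "slice v m (p - q) = slice v m p - slice v m q"
  by (rule poly_eqI) (simp add: coeff_slice lookup_minus)

lemma slice_Cst: "slice v m (Cst c) = [:if m = 0 then c else 0:]"
proof (rule poly_eqI)
  fix k
  have "m + Poly_Mapping.single v k = 0 \<longleftrightarrow> m = 0 \<and> k = 0"
    by (auto simp: poly_mapping_eq_iff fun_eq_iff lookup_add)
      (metis lookup_single_eq)
  then show "coeff (slice v m (Cst c)) k = coeff [:if m = 0 then c else 0:] k"
    by (auto simp: coeff_slice Cst_def lookup_single when_def coeff_pCons split: nat.split)
qed

lemma slice_Var_same:
  assumes "Poly_Mapping.lookup m v = 0"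
  shows "slice v m (Var v * p) = pCons 0 (slice v m p)"
proof (rule poly_eqI)
  fix k
  have "m + Poly_Mapping.single v (Suc i) - Poly_Mapping.single v 1 = m + Poly_Mapping.single v i" for i
    by (rule poly_mapping_eqI) (auto simp: lookup_add lookup_minus lookup_single when_def)
  then show "coeff (slice v m (Var v * p)) k = coeff (pCons 0 (slice v m p)) k"
    using assms by (auto simp: coeff_slice lookup_Var_mult lookup_add coeff_pCons split: nat.split)
qed

lemma slice_Var_other:
  assumes "w \<noteq> v"
  shows "slice v m (Var w * p) =
    (if Poly_Mapping.lookup m w = 0 then 0 else slice v (m - Poly_Mapping.single w 1) p)"
proof (rule poly_eqI)
  fix k
  have "m + Poly_Mapping.single v k - Poly_Mapping.single w 1 =
      m - Poly_Mapping.single w 1 + Poly_Mapping.single v k"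
    using assms by (intro poly_mapping_eqI) (auto simp: lookup_add lookup_minus lookup_single when_def)
  then show "coeff (slice v m (Var w * p)) k = coeff (if Poly_Mapping.lookup m w = 0 then 0
      else slice v (m - Poly_Mapping.single w 1) p) k"
    using assms by (auto simp: coeff_slice lookup_Var_mult lookup_add lookup_single when_def)
qed

text \<open>The shift of \<open>v\<close> is linear over the polynomials in the other variables, so it acts on each
  slice separately; this reduces questions about it to one variable over \<open>\<complex>\<close>.\<close>

lemma slice_shift:
  assumes "Poly_Mapping.lookup m v = 0"
  shows "slice v m (shift v p) = pcompose (slice v m p) [:-1, 1:]"
  using assms
proof (induction p arbitrary: m rule: mpol_induct)
  case (Cst c)
  show ?case by (simp add: shift_def slice_Cst)
next
  case (add p q)
  then show ?case by (simp add: shift_def subst_add slice_add pcompose_add)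
next
  case (Var w p)
  show ?case
  proof (cases "w = v")
    case True
    then have "shift v (Var w * p) = Var v * shift v p - shift v p"
      by (simp add: shift_def subst_mult algebra_simps)
    then show ?thesis
      using Var True by (simp add: slice_diff slice_Var_same pcompose_pCons)
  next
    case False
    then have "shift v (Var w * p) = Var w * shift v p"
      by (simp add: shift_def subst_mult)
    moreover have "Poly_Mapping.lookup (m - Poly_Mapping.single w 1) v = 0"
      using Var.prems by (simp add: lookup_minus)
    ultimately show ?thesis
      using Var.IH False by (simp add: slice_Var_other)
  qed
qed

lemma split_exponent:
  fixes m :: "'v \<Rightarrow>\<^sub>0 nat"
  obtains m' where "Poly_Mapping.lookup m' v = 0"
    "m = m' + Poly_Mapping.single v (Poly_Mapping.lookup m v)"
proof
  let ?m' = "m - Poly_Mapping.single v (Poly_Mapping.lookup m v)"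
  show "Poly_Mapping.lookup ?m' v = 0" by (simp add: lookup_minus)
  show "m = ?m' + Poly_Mapping.single v (Poly_Mapping.lookup m v)"
    by (rule poly_mapping_eqI) (auto simp: lookup_add lookup_minus lookup_single when_def)
qed

text \<open>A polynomial of period one takes its value at \<open>0\<close> at every natural number.\<close>

lemma periodic_poly_const:
  fixes q :: "complex poly"
  assumes "pcompose q [:-1, 1:] = q"
  shows "degree q = 0"
proof -
  have step: "poly q (z - 1) = poly q z" for z
    using arg_cong[OF assms, of "\<lambda>r. poly r z"] by (simp add: poly_pcompose add.commute)
  have "poly q (of_nat k) = poly q 0" for k
    by (induction k) (use step[of "1 + of_nat _"] in \<open>simp_all add: step\<close>)
  then have "range (of_nat :: nat \<Rightarrow> complex) \<subseteq> {z. poly (q - [:poly q 0:]) z = 0}"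
    by auto
  moreover have "infinite (range (of_nat :: nat \<Rightarrow> complex))"
    by (simp add: finite_image_iff inj_of_nat)
  ultimately have "q - [:poly q 0:] = 0"
    using poly_roots_finite finite_subset by blast
  then have "q = [:poly q 0:]" by simp
  then show ?thesis by (metis degree_pCons_0)
qed

lemma shift_fixed_imp_no_var:
  assumes "shift v p = p" "m \<in> Poly_Mapping.keys p"
  shows "Poly_Mapping.lookup m v = 0"
proof -
  obtain m' where m': "Poly_Mapping.lookup m' v = 0"
    "m = m' + Poly_Mapping.single v (Poly_Mapping.lookup m v)"
    by (rule split_exponent)
  have "degree (slice v m' p) = 0"
    using slice_shift[OF m'(1), of p] assms(1) by (intro periodic_poly_const) simp
  moreover have "coeff (slice v m' p) (Poly_Mapping.lookup m v) \<noteq> 0"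
    using assms(2) m'(2) by (simp add: coeff_slice in_keys_iff)
  ultimately show ?thesis using le_degree by fastforce
qed

definition degree_in_le :: "'v set \<Rightarrow> nat \<Rightarrow> 'v mpol \<Rightarrow> bool" where
  "degree_in_le S k p \<longleftrightarrow>
     (\<forall>m\<in>Poly_Mapping.keys p. (\<Sum>v\<in>S. Poly_Mapping.lookup m v) \<le> k)"

lemma degree_in_le_exists: "\<exists>k. degree_in_le S k p"
proof
  show "degree_in_le S (Max ((\<lambda>m. \<Sum>v\<in>S. Poly_Mapping.lookup m v) ` Poly_Mapping.keys p)) p"
    unfolding degree_in_le_def by (intro ballI Max_ge finite_imageI imageI) simp_all
qed

lemma degree_in_le_Var_mult:
  assumes "degree_in_le S k p" "w \<notin> S"
  shows "degree_in_le S k (Var w * p)"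
  unfolding degree_in_le_def
proof
  fix m assume "m \<in> Poly_Mapping.keys (Var w * p)"
  then have "m - Poly_Mapping.single w 1 \<in> Poly_Mapping.keys p"
    by (auto simp: in_keys_iff lookup_Var_mult split: if_splits)
  then have "(\<Sum>v\<in>S. Poly_Mapping.lookup (m - Poly_Mapping.single w 1) v) \<le> k"
    using assms(1) by (simp add: degree_in_le_def)
  moreover have "(\<Sum>v\<in>S. Poly_Mapping.lookup (m - Poly_Mapping.single w 1) v) =
      (\<Sum>v\<in>S. Poly_Mapping.lookup m v)"
    using assms(2) by (intro sum.cong) (auto simp: lookup_minus lookup_single when_def)
  ultimately show "(\<Sum>v\<in>S. Poly_Mapping.lookup m v) \<le> k" by simp
qed

lemma coeff_pcompose_shift_top:
  fixes q :: "complex poly"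
  assumes "degree q \<le> k"
  shows "coeff (pcompose q [:-1, 1:]) k = coeff q k"
proof (cases "degree q = k")
  case True
  then show ?thesis
    using lead_coeff_comp[of "[:-1, 1:] :: complex poly" q] by (simp add: degree_pcompose)
next
  case False
  then show ?thesis using assms by (simp add: coeff_eq_0 degree_pcompose)
qed

text \<open>For a monomial \<open>m' v\<^sup>e\<close> of top degree, the slice at \<open>m'\<close> has degree at most \<open>e\<close>, since a larger
  power of \<open>v\<close> would exceed the degree bound.  Its coefficient at \<open>e\<close> then survives the shift
  unchanged and cancels in the difference.\<close>

lemma degree_in_le_shift_diff:
  fixes S :: "'v::finite set"
  assumes "degree_in_le S (Suc k) p" "v \<in> S"
  shows "degree_in_le S k (shift v p - p)"
  unfolding degree_in_le_def
proof (rule ballI, rule ccontr)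
  fix m
  assume m: "m \<in> Poly_Mapping.keys (shift v p - p)"
    and "\<not> (\<Sum>w\<in>S. Poly_Mapping.lookup m w) \<le> k"
  then have large: "Suc k \<le> (\<Sum>w\<in>S. Poly_Mapping.lookup m w)" by simp
  obtain m' where m': "Poly_Mapping.lookup m' v = 0"
    "m = m' + Poly_Mapping.single v (Poly_Mapping.lookup m v)"
    by (rule split_exponent)
  define e where "e = Poly_Mapping.lookup m v"
  have m_eq: "m = m' + Poly_Mapping.single v e" using m'(2) by (simp add: e_def)
  have "degree (slice v m' p) \<le> e"
  proof (rule degree_le, intro allI impI)
    fix i assume "e < i"
    have "(\<Sum>w\<in>S. Poly_Mapping.lookup m w) < (\<Sum>w\<in>S. Poly_Mapping.lookup (m' + Poly_Mapping.single v i) w)"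
      by (rule sum_strict_mono_ex1)
        (use \<open>e < i\<close> assms(2) in \<open>auto simp: m_eq lookup_add lookup_single when_def\<close>)
    with large have "m' + Poly_Mapping.single v i \<notin> Poly_Mapping.keys p"
      using assms(1) by (force simp: degree_in_le_def)
    then show "coeff (slice v m' p) i = 0" by (simp add: coeff_slice in_keys_iff)
  qed
  then have "coeff (slice v m' (shift v p - p)) e = 0"
    by (simp add: slice_diff slice_shift[OF m'(1)] coeff_pcompose_shift_top)
  then show False using m by (simp add: coeff_slice in_keys_iff flip: m_eq)
qed

text \<open>Each step replaces \<open>p\<close> by \<open>Var w * (shift v p - p)\<close> for a variable \<open>v\<close> that occurs in \<open>p\<close>:
  the degree in \<open>S\<close> drops, and the result is nonzero.  The factor \<open>Var w\<close> is there because the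
  action provides shifts only up to such a multiple; as \<open>w \<notin> S\<close> it does not affect the degree.\<close>

lemma descent_to_degree_zero:
  fixes S :: "'v::finite set"
  assumes closed: "\<And>v p. v \<in> S \<Longrightarrow> p \<in> N \<Longrightarrow> Var w * (shift v p - p) \<in> N"
    and "w \<notin> S" "p \<in> N" "p \<noteq> 0"
  shows "\<exists>q\<in>N. q \<noteq> 0 \<and> degree_in_le S 0 q"
proof -
  obtain k where "degree_in_le S k p" using degree_in_le_exists by blast
  then show ?thesis using assms(3,4)
  proof (induction k arbitrary: p)
    case 0
    then show ?case by blast
  next
    case (Suc k)
    show ?case
    proof (cases "\<forall>v\<in>S. shift v p = p")
      case True
      then have "degree_in_le S 0 p"
        by (auto simp: degree_in_le_def intro: shift_fixed_imp_no_var)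
      then show ?thesis using Suc by blast
    next
      case False
      then obtain v where v: "v \<in> S" "shift v p - p \<noteq> 0" by auto
      show ?thesis
      proof (rule Suc.IH)
        show "degree_in_le S k (Var w * (shift v p - p))"
          using Suc.prems v \<open>w \<notin> S\<close>
          by (intro degree_in_le_Var_mult degree_in_le_shift_diff) auto
        show "Var w * (shift v p - p) \<in> N" by (rule closed) (use v Suc in auto)
        show "Var w * (shift v p - p) \<noteq> 0" using v by (simp add: Var_mult_eq_0_iff)
      qed
    qed
  qed
qed

lemma tau_eq_shift: "tau j = shift (Inr j)"
  by (simp add: tau_def shift_def)

definition eval_d0 :: "('l::finite + 'n::finite) mpol \<Rightarrow> 'l mpol" where
  "eval_d0 = subst (\<lambda>v. case v of Inl i \<Rightarrow> Var i | Inr j \<Rightarrow> 0)"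

lemma eval_d0_embed [simp]: "eval_d0 (embed_h f) = f"
  by (simp add: eval_d0_def embed_h_def subst_subst)

lemma inj_embed: "inj (embed_h :: 'l::finite mpol \<Rightarrow> ('l + 'n::finite) mpol)"
  by (metis eval_d0_embed injI)

lemma eval_d0_d_monom: "eval_d0 (d_monom e) = (if \<forall>j. e j = 0 then 1 else 0)"
  unfolding eval_d0_def d_monom_def subst_prod subst_power subst_Var
  by (auto simp: power_0_left intro!: prod_zero)

lemma eval_d0_mult: "eval_d0 (p * q) = eval_d0 p * eval_d0 q"
  by (simp add: eval_d0_def subst_mult)

lemma subst_cong_keys:
  assumes "\<And>m v. m \<in> Poly_Mapping.keys p \<Longrightarrow> Poly_Mapping.lookup m v \<noteq> 0 \<Longrightarrow> \<theta> v = \<theta>' v"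
  shows "subst \<theta> p = subst \<theta>' p"
  unfolding subst_def lin_ext_def
proof (intro sum.cong refl arg_cong2[where f = "(*)"] prod.cong)
  fix m v assume "m \<in> Poly_Mapping.keys p"
  with assms[of m v] show "\<theta> v ^ Poly_Mapping.lookup m v = \<theta>' v ^ Poly_Mapping.lookup m v"
    by (cases "Poly_Mapping.lookup m v = 0") auto
qed

text \<open>Both sides are substitutions into \<open>g\<close> that agree on every variable occurring in \<open>g\<close>.\<close>

lemma d_free_eq_embed:
  fixes g :: "('l::finite + 'n::finite) mpol"
  assumes "degree_in_le (range Inr) 0 g"
  shows "g = embed_h (eval_d0 g)"
proof -
  have "embed_h (eval_d0 g) = subst (\<lambda>v. case v of Inl i \<Rightarrow> Var (Inl i) | Inr j \<Rightarrow> 0) g"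
    unfolding eval_d0_def embed_h_def subst_subst
    by (rule arg_cong[where f = "\<lambda>\<theta>. subst \<theta> g"]) (auto simp: fun_eq_iff split: sum.split)
  also have "\<dots> = subst Var g"
  proof (rule subst_cong_keys)
    fix m and v :: "'l + 'n"
    assume "m \<in> Poly_Mapping.keys g" "Poly_Mapping.lookup m v \<noteq> 0"
    then show "(case v of Inl i \<Rightarrow> Var (Inl i) | Inr j \<Rightarrow> 0) = Var v"
      using assms by (cases v) (auto simp: degree_in_le_def)
  qed
  finally show ?thesis by simp
qed

section \<open>Extension of subspaces along the d-variables\<close>

interpretation mpol: vector_space "mscale :: complex \<Rightarrow> 'v mpol \<Rightarrow> 'v mpol"
  by (rule vector_space_mscale)

lemma subspace_Var_closed_eq_UNIV:
  fixes N :: "('v::finite) mpol set"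
  assumes "mpol.subspace N" "1 \<in> N" "\<And>v p. p \<in> N \<Longrightarrow> Var v * p \<in> N"
  shows "N = UNIV"
proof -
  have "p \<in> N" for p
  proof (induction p rule: mpol_induct)
    case (Cst c)
    show ?case using mpol.subspace_scale[OF assms(1,2), of c] by (simp add: mscale_def)
  qed (use assms in \<open>auto intro: mpol.subspace_add\<close>)
  then show ?thesis by auto
qed

text \<open>\<open>W \<otimes> \<complex>[d\<^sub>1, \<dots>, d\<^sub>n]\<close>, for a subspace \<open>W\<close> of \<open>U(\<hh>)\<close>.\<close>

definition tensor_d :: "'l mpol set \<Rightarrow> ('l::finite + 'n::finite) mpol set" where
  "tensor_d W = mpol.span {embed_h f * d_monom e |f e. f \<in> W}"

lemma subspace_tensor_d: "mpol.subspace (tensor_d W)"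
  unfolding tensor_d_def by (rule mpol.subspace_span)

lemma tensor_d_generator: "f \<in> W \<Longrightarrow> embed_h f * d_monom e \<in> tensor_d W"
  unfolding tensor_d_def by (rule mpol.span_base) blast

lemma tensor_d_embed: "f \<in> W \<Longrightarrow> embed_h f \<in> tensor_d W"
  using tensor_d_generator[of f W "\<lambda>_. 0"] by (simp add: d_monom_def)

lemma linear_image_tensor_d:
  assumes "g \<in> tensor_d W"
    and "mpol.subspace T"
    and "\<And>p q. F (p + q) = F p + F q" "\<And>c p. F (mscale c p) = mscale c (F p)"
    and "\<And>f e. f \<in> W \<Longrightarrow> F (embed_h f * d_monom e) \<in> T"
  shows "F g \<in> T"
  using assms(1) unfolding tensor_d_def
proof (induction rule: mpol.span_induct_alt)
  case base
  show ?case using assms(3)[of 0 0] mpol.subspace_0[OF assms(2)] by simp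
next
  case (step c p q)
  then show ?case
    using assms(2,5) by (auto simp: assms(3,4) intro: mpol.subspace_add mpol.subspace_scale)
qed

text \<open>Setting all \<open>d\<^sub>j\<close> to zero maps \<open>W \<otimes> \<complex>[d]\<close> into \<open>W\<close> and undoes the embedding.\<close>

lemma embed_in_tensor_d_iff:
  fixes W :: "'l::finite mpol set"
  assumes "mpol.subspace W"
  shows "(embed_h f :: ('l + 'n::finite) mpol) \<in> tensor_d W \<longleftrightarrow> f \<in> W"
proof
  assume "(embed_h f :: ('l + 'n) mpol) \<in> tensor_d W"
  then have "eval_d0 (embed_h f :: ('l + 'n) mpol) \<in> W"
  proof (rule linear_image_tensor_d[OF _ assms])
    fix f :: "'l mpol" and e :: "'n \<Rightarrow> nat"
    assume "f \<in> W"
    moreover have "eval_d0 (embed_h f * d_monom e) = (if \<forall>j. e j = 0 then f else 0)"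
      by (simp add: eval_d0_mult eval_d0_d_monom)
    ultimately show "eval_d0 (embed_h f * d_monom e) \<in> W"
      using mpol.subspace_0[OF assms] by simp
  qed (simp_all add: eval_d0_def subst_add subst_mscale)
  then show "f \<in> W" by simp
qed (rule tensor_d_embed)

lemma tensor_d_mult_Cst:
  "g \<in> tensor_d W \<Longrightarrow> g * Cst c \<in> tensor_d W"
  using mpol.subspace_scale[OF subspace_tensor_d, of g W c] by (simp add: mscale_def mult.commute)

lemma tensor_d_mult_d:
  assumes "g \<in> tensor_d W" shows "g * Var (Inr j) \<in> tensor_d W"
  using assms
  by (rule linear_image_tensor_d[OF _ subspace_tensor_d])
    (simp_all add: distrib_right mscale_mult mult.assoc d_monom_Suc tensor_d_generator)

lemma tensor_d_mult_d_linear: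
  assumes "g \<in> tensor_d W" shows "g * (Var (Inr j) - Cst c) \<in> tensor_d W"
  using mpol.subspace_diff[OF subspace_tensor_d tensor_d_mult_d[OF assms] tensor_d_mult_Cst[OF assms]]
  by (simp add: right_diff_distrib)

lemma tensor_d_mult_power:
  "(\<And>g. g \<in> tensor_d W \<Longrightarrow> g * q \<in> tensor_d W) \<Longrightarrow> g \<in> tensor_d W \<Longrightarrow> g * q ^ k \<in> tensor_d W"
  by (induction k arbitrary: g) (simp_all flip: mult.assoc)

lemma tensor_d_mult_prod:
  assumes "\<And>a g. a \<in> A \<Longrightarrow> g \<in> tensor_d W \<Longrightarrow> g * q a \<in> tensor_d W"
  shows "g \<in> tensor_d W \<Longrightarrow> g * prod q A \<in> tensor_d W"
  using assms
  by (induction A arbitrary: g rule: infinite_finite_induct) (simp_all flip: mult.assoc)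

text \<open>\<open>\<tau>\<^sup>r\<close> fixes \<open>W\<close> and turns a monomial in the \<open>d\<^sub>j\<close> into a product of factors \<open>d\<^sub>j - r\<^sub>j\<close>.\<close>

lemma tensor_d_tau_pow:
  assumes "g \<in> tensor_d W" shows "tau_pow r g \<in> tensor_d W"
  using assms
proof (rule linear_image_tensor_d[OF _ subspace_tensor_d])
  \<comment> \<open>The identity supplies the linear map relative to which \<open>\<tau>\<^sup>r\<close> on monomials is computed.\<close>
  interpret mscale_linear "\<lambda>f :: 'a mpol. f" by unfold_locales simp_all
  fix f e assume "f \<in> W"
  then show "tau_pow r (embed_h f * d_monom e) \<in> tensor_d W"
    unfolding tau_pow_mult tau_pow_embed tau_pow_d_monom
    by (intro tensor_d_mult_prod tensor_d_mult_power tensor_d_mult_d_linear tensor_d_embed)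
qed (simp_all add: tau_pow_plus tau_pow_mscale)

lemma tensor_d_mult_d_pol:
  assumes "g \<in> tensor_d W" shows "g * d_pol a r u \<in> tensor_d W"
  unfolding d_pol_def right_diff_distrib sum_distrib_left mscale_mult
  by (intro mpol.subspace_diff[OF subspace_tensor_d] mpol.subspace_sum[OF subspace_tensor_d]
      mpol.subspace_scale[OF subspace_tensor_d] tensor_d_mult_d tensor_d_mult_Cst assms)

lemma simple_lie_module_submodule:
  assumes "simple_lie_module sG b sV act" "module.subspace sV W" "\<And>z w. w \<in> W \<Longrightarrow> act z w \<in> W"
  shows "W = {0} \<or> W = UNIV"
  by (rule assms(1)[unfolded simple_lie_module_def, THEN conjunct2, THEN conjunct2, THEN spec, THEN mp])
    (use assms(2,3) in simp)

section \<open>Simplicity of the toroidal module\<close>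

context M_hat_data
begin

text \<open>The defining conditions prescribe the action only on generators; \<open>hat_act\<close> describes it on every
  element of the Lie algebra.\<close>

lemma M_hat_eq: "M_hat scale br c1 c2 x y H \<Lambda> a \<rho> = hat_act \<Lambda> a \<rho>"
  by (rule is_M_hat_unique[OF M_hat_spec hat_act_is_M_hat])
    (use chevalley_lie_algebra_axioms M \<Lambda> in auto)

lemma hat_act_loop:
  "hat_act \<Lambda> a \<rho> (loop_elt z r) g = mscale (lam_pow \<Lambda> r) (ext_act (\<rho> z) (tau_pow r g))"
  by (simp add: hat_act_def loop_elt_def loop_single)

lemma hat_act_d: "hat_act \<Lambda> a \<rho> (D_elt 0 j) g = Var (Inr j) * g"
  by (simp add: hat_act_def D_elt_def tD_def der_single d_pol_axis lam_pow_def tau_pow_zero mult.commute)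

lemma lam_pow_nonzero: "lam_pow \<Lambda> r \<noteq> 0"
  using \<Lambda> by (simp add: lam_pow_def)

lemma tensor_d_submodule:
  assumes W: "mpol.subspace W" "\<And>z f. f \<in> W \<Longrightarrow> \<rho> z f \<in> W" and g: "g \<in> tensor_d W"
  shows "hat_act \<Lambda> a \<rho> X g \<in> tensor_d W"
proof -
  have ext: "ext_act (\<rho> z) p \<in> tensor_d W" if "p \<in> tensor_d W" for z p
    using that
    by (rule linear_image_tensor_d[OF _ subspace_tensor_d])
      (simp_all add: rho.ext_add rho.ext_mscale rho.ext_monom tensor_d_generator W(2))
  obtain f k D where "X = (f, k, D)" by (metis prod.exhaust)
  then show ?thesis
    unfolding hat_act_def loop_part_def der_part_def lin_ext_def prod.case
    by (intro mpol.subspace_add[OF subspace_tensor_d] mpol.subspace_sum[OF subspace_tensor_d]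
        mpol.subspace_scale[OF subspace_tensor_d] ext tensor_d_mult_d_pol tensor_d_tau_pow g | simp)+
qed

text \<open>A submodule \<open>W\<close> of \<open>M\<^sub>\<gg>\<close> is proper and nonzero if and only if \<open>W \<otimes> \<complex>[d]\<close> is.\<close>

lemma simple_if_simple_hat:
  assumes "simple_lie_module (tor_scale scale) (tor_br scale br c1 c2) mscale (hat_act \<Lambda> a \<rho>)"
  shows "simple_lie_module scale br mscale \<rho>"
  unfolding simple_lie_module_def
proof (intro conjI allI impI)
  show "lie_module scale br mscale \<rho>" by (rule \<rho>_module)
  show "(UNIV :: 'l mpol set) \<noteq> {0}" by (metis UNIV_I singletonD zero_neq_one)
  fix W :: "'l mpol set"
  assume W: "mpol.subspace W \<and> (\<forall>z. \<forall>w\<in>W. \<rho> z w \<in> W)"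
  have "tensor_d W = ({0} :: ('l + 'n) mpol set) \<or> tensor_d W = (UNIV :: ('l + 'n) mpol set)"
    by (rule simple_lie_module_submodule[OF assms subspace_tensor_d])
      (use W in \<open>simp add: tensor_d_submodule\<close>)
  then show "W = {0} \<or> W = UNIV"
  proof
    assume *: "tensor_d W = ({0} :: ('l + 'n) mpol set)"
    have "f = 0" if "f \<in> W" for f
    proof -
      from that have "(embed_h f :: ('l + 'n) mpol) \<in> tensor_d W" by (rule tensor_d_embed)
      with * have "(embed_h f :: ('l + 'n) mpol) = embed_h 0" by simp
      then show ?thesis by (rule inj_embed[THEN injD])
    qed
    then show ?thesis using mpol.subspace_0[of W] W by auto
  next
    assume *: "tensor_d W = (UNIV :: ('l + 'n) mpol set)"
    have "f \<in> W" for f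
    proof -
      have "(embed_h f :: ('l + 'n) mpol) \<in> tensor_d W" by (simp add: *)
      then show ?thesis using W by (simp add: embed_in_tensor_d_iff)
    qed
    then show ?thesis by auto
  qed
qed

text \<open>The trace \<open>W\<close> of \<open>N\<close> on \<open>U(\<hh>)\<close> is a \<open>\<gg>\<close>-submodule.  If it is everything, it contains \<open>1\<close> and
  \<open>N\<close> is the whole module; if it is zero, the descent shows that \<open>N\<close> is zero.\<close>

lemma simple_hat_if_simple:
  assumes "simple_lie_module scale br mscale \<rho>"
  shows "simple_lie_module (tor_scale scale) (tor_br scale br c1 c2) mscale (hat_act \<Lambda> a \<rho>)"
  unfolding simple_lie_module_def
proof (intro conjI allI impI)
  show "lie_module (tor_scale scale) (tor_br scale br c1 c2) mscale (hat_act \<Lambda> a \<rho>)"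
    by (rule hat_act_module)
  show "(UNIV :: ('l + 'n) mpol set) \<noteq> {0}" by (metis UNIV_I singletonD zero_neq_one)
  fix N :: "('l + 'n) mpol set"
  assume "mpol.subspace N \<and> (\<forall>X. \<forall>g\<in>N. hat_act \<Lambda> a \<rho> X g \<in> N)"
  then have sub: "mpol.subspace N" and act: "\<And>X g. g \<in> N \<Longrightarrow> hat_act \<Lambda> a \<rho> X g \<in> N"
    by auto
  have loop: "ext_act (\<rho> z) (tau_pow r g) \<in> N" if "g \<in> N" for z r g
    \<comment> \<open>The scalar \<open>\<Lambda>\<^sup>r\<close> in the action is nonzero and can be divided out.\<close>
    using mpol.subspace_scale[OF sub act[OF that, of "loop_elt z r"], of "inverse (lam_pow \<Lambda> r)"]
    by (simp add: hat_act_loop mscale_mscale lam_pow_nonzero)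
  have ext_H: "ext_act (\<rho> (H i)) g = Var (Inl i) * g" for i and g :: "('l + 'n) mpol"
    by (induction g rule: mpol_sum_induct)
      (simp add: rho.ext_add distrib_left, simp add: rho.ext_monom, simp add: \<rho>_H embed_mult mult.assoc)
  have H_tau: "Var (Inl i) * tau_pow r g \<in> N" if "g \<in> N" for i r g
    using loop[OF that, of "H i" r] by (simp add: ext_H)
  have Var_N: "Var v * g \<in> N" if "g \<in> N" for v g
    using H_tau[OF that, of _ 0] act[OF that, of "D_elt 0 _"]
    by (cases v) (simp_all add: tau_pow_zero hat_act_d)
  show "N = {0} \<or> N = UNIV"
  proof (rule disjCI)
    assume "N \<noteq> UNIV"
    define W where "W = {f. embed_h f \<in> N}"
    have W: "mpol.subspace W \<and> (\<forall>z. \<forall>f\<in>W. \<rho> z f \<in> W)"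
    proof (intro conjI allI ballI)
      show "mpol.subspace W"
        unfolding mpol.subspace_def W_def
        using sub by (auto simp: embed_add embed_mscale
            intro: mpol.subspace_0 mpol.subspace_add mpol.subspace_scale)
      show "\<rho> z f \<in> W" if "f \<in> W" for z f
        using loop[of "embed_h f" z 0] that by (simp add: W_def tau_pow_zero rho.ext_embed)
    qed
    have "W = {0} \<or> W = UNIV"
      by (rule simple_lie_module_submodule[OF assms]) (use W in simp_all)
    moreover have "W \<noteq> UNIV"
    proof
      assume "W = UNIV"
      then have "1 \<in> W" by simp
      then have "1 \<in> N" by (simp add: W_def)
      then have "N = UNIV"
        using sub Var_N by (intro subspace_Var_closed_eq_UNIV) simp_all
      with \<open>N \<noteq> UNIV\<close> show False by simp
    qed
    ultimately have W0: "W = {0}" by simp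
    have "p = 0" if "p \<in> N" for p
    proof (rule ccontr)
      assume "p \<noteq> 0"
      \<comment> \<open>The rank is positive, so there is some \<open>H\<^sub>i\<close> to use as the factor in the descent.\<close>
      obtain i :: 'l where True by simp
      have "Var (Inl i) * (shift v g - g) \<in> N" if "v \<in> range Inr" "g \<in> N" for v g
      proof -
        from that(1) obtain j where v: "v = Inr j" by auto
        have "Var (Inl i) * tau_pow (axis j 1) g - Var (Inl i) * g \<in> N"
          by (intro mpol.subspace_diff[OF sub] H_tau Var_N that(2))
        then show ?thesis by (simp add: v tau_pow_axis tau_eq_shift right_diff_distrib)
      qed
      from descent_to_degree_zero[of "range Inr" N "Inl i", OF this _ \<open>p \<in> N\<close> \<open>p \<noteq> 0\<close>]
      obtain q where q: "q \<in> N" "q \<noteq> 0" "degree_in_le (range Inr) 0 q" by auto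
      from d_free_eq_embed[OF q(3)] q(1) have "eval_d0 q \<in> W" by (simp add: W_def)
      with W0 d_free_eq_embed[OF q(3)] q(2) show False by simp
    qed
    then show "N = {0}" using mpol.subspace_0[OF sub] by auto
  qed
qed

end

theorem proposition5p1:
  fixes sc :: "complex \<Rightarrow> 'g::ab_group_add \<Rightarrow> 'g"
    and br :: "'g \<Rightarrow> 'g \<Rightarrow> 'g"
    and \<hh> :: "'g set"
    and x y h H :: "'l::finite \<Rightarrow> 'g"
    and c1 c2 a :: complex
    and \<Lambda> :: "complex ^ 'n::finite"
    and \<rho> :: "'g \<Rightarrow> 'l mpol \<Rightarrow> 'l mpol"
  assumes "chevalley_lie_algebra sc br \<hh> x y h H"
    and "\<And>j. \<Lambda> $ j \<noteq> 0"
    and "M_cat sc br H \<rho>"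
  shows "simple_lie_module (tor_scale sc) (tor_br sc br c1 c2) mscale
           (M_hat sc br c1 c2 x y H \<Lambda> a \<rho>)
         \<longleftrightarrow> simple_lie_module sc br mscale \<rho>"
proof -
  interpret chevalley_lie_algebra sc br \<hh> x y h H by fact
  interpret M_hat_data sc br \<hh> x y h H \<rho> \<Lambda> by unfold_locales (use assms in auto)
  show ?thesis
    unfolding M_hat_eq using simple_if_simple_hat simple_hat_if_simple by blast
qed

end
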